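(* Let $\theta\in(0,\pi/2)$, let $\mu$ be the probability measure on $\Omega=\{1,2\}^{\mathbb N}$ defined in the context, and let $A:\Omega\to\mathbb R$ depend only on the first coordinate, $A(x_1,x_2,\dots)=A(x_1)$. Then for every $t\in\mathbb R$ the free energy $$c(t)=\lim_{n\to\infty}\frac1n\log\int e^{t\,(A(x)+A(\sigma(x))+\cdots+A(\sigma^{n-1}(x)))}\,d\mu(x)$$ exists and is given by $$c(t)=\frac12\log\Big(\big[e^{tA(1)}+e^{tA(2)}\big]^2-\sin^2(2\theta)\big[e^{tA(1)}-e^{tA(2)}\big]^2\Big)-\log 2,$$ and there exists a large deviation principle for $\mu$ and $A$.
   Context: Let $\sigma^x=\begin{pmatrix}0&1\\1&0\end{pmatrix}$ and $H=\sigma^x\otimes\sigma^x$ acting on $\mathbb C^2\otimes\mathbb C^2$. For $n\ge 2$ let $H_n=\sum_{i=0}^{n-2}I^{\otimes i}\otimes H\otimes I^{\otimes(n-i-2)}$ on $(\mathbb C^2)^{\otimes n}$. For $\theta\in(0,\pi/2)$ let $P_1,P_2$ be the orthogonal projections of $\mathbb C^2$ onto the lines spanned by $\psi_1=(\cos\theta,\sin\theta)$ and $\psi_2=(-\sin\theta,\cos\theta)$. For $\beta>0$ and $(j_1,\dots,j_n)\in\{1,2\}^n$ put $$\mu_{\beta,n}(j_1,\dots,j_n)=\frac{\mathrm{Tr}\big[e^{-\beta H_n}(P_{j_1}\otimes\cdots\otimes P_{j_n})\big]}{\mathrm{Tr}(e^{-\beta H_n})},\qquad \mu_{\infty,n}=\lim_{\beta\to+\infty}\mu_{\beta,n}.$$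 $\mu$ is the unique Borel probability measure on $\Omega$ with $\mu(\{x: x_1=j_1,\dots,x_n=j_n\})=\mu_{\infty,n}(j_1,\dots,j_n)$ for all $n\ge2$ and all $(j_1,\dots,j_n)$. The shift is $\sigma(x_1,x_2,\dots)=(x_2,x_3,\dots)$. A large deviation principle holds for $\mu$ and $A$ if there is a lower semicontinuous function $I:\mathbb R\to[0,+\infty]$ such that, with $\log 0=-\infty$: (a) for every closed $K\subset\mathbb R$, $\limsup_{n}\frac1n\log\mu\{z:\frac1n\sum_{j=0}^{n-1}A(\sigma^j(z))\in K\}\le-\inf_{s\in K}I(s)$; (b) for every open $B\subset\mathbb R$, $\liminf_{n}\frac1n\log\mu\{z:\frac1n\sum_{j=0}^{n-1}A(\sigma^j(z))\in B\}\ge-\inf_{s\in B}I(s)$. *)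

theory Defs
  imports "Jordan_Normal_Form.Matrix" "HOL-Probability.Probability"
begin

text \<open>
  Operators on the \<open>n\<close>-fold tensor power of \<open>\<complex>\<^sup>2\<close> are matrices of size \<open>2 ^ n\<close>, written in
  the lexicographically ordered product basis, so that the tensor product of operators is
  the Kronecker product.
\<close>

no_notation vec_nth (infixl \<open>$\<close> 90)

definition kronecker :: "complex mat \<Rightarrow> complex mat \<Rightarrow> complex mat" (infixl \<open>\<otimes>\<^sub>K\<close> 72) where
  "A \<otimes>\<^sub>K B = Matrix.mat (dim_row A * dim_row B) (dim_col A * dim_col B)
     (\<lambda>(i, j). A $$ (i div dim_row B, j div dim_col B) * B $$ (i mod dim_row B, j mod dim_col B))"

definition kronecker_list :: "complex mat list \<Rightarrow> complex mat" where
  "kronecker_list As = foldr (\<otimes>\<^sub>K) As (1\<^sub>m 1)"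

abbreviation kronecker_power :: "complex mat \<Rightarrow> nat \<Rightarrow> complex mat" where
  "kronecker_power A k \<equiv> kronecker_list (replicate k A)"

definition mat_trace :: "complex mat \<Rightarrow> complex" where
  "mat_trace A = (\<Sum>i<dim_row A. A $$ (i, i))"

definition mat_exp :: "complex mat \<Rightarrow> complex mat" where
  "mat_exp A = Matrix.mat (dim_row A) (dim_row A) (\<lambda>(i, j). \<Sum>k. (A ^\<^sub>m k) $$ (i, j) / fact k)"

definition sigma_x :: "complex mat" where
  "sigma_x = mat_of_rows_list 2 [[0, 1], [1, 0]]"

definition two_site_H :: "complex mat" where
  "two_site_H = sigma_x \<otimes>\<^sub>K sigma_x"

text \<open>Sums of matrices are taken entrywise because \<^typ>\<open>complex mat\<close>, which contains matrices
  of all sizes, is not an additive monoid.\<close>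

definition H_chain :: "nat \<Rightarrow> complex mat" where
  "H_chain n = Matrix.mat (2 ^ n) (2 ^ n) (\<lambda>(a, b). \<Sum>i=0..n-2.
     (kronecker_power (1\<^sub>m 2) i \<otimes>\<^sub>K two_site_H \<otimes>\<^sub>K kronecker_power (1\<^sub>m 2) (n - i - 2)) $$ (a, b))"

text \<open>The orthogonal projection \<open>x \<mapsto> (\<langle>x, v\<rangle> / \<langle>v, v\<rangle>) v\<close> onto the line spanned by \<open>v \<noteq> 0\<close>.\<close>

definition line_proj :: "complex Matrix.vec \<Rightarrow> complex mat" where
  "line_proj v = Matrix.mat (dim_vec v) (dim_vec v)
     (\<lambda>(i, k). v $ i * conjugate (v $ k) / (v \<bullet>c v))"

lemma line_proj_mult_vec:
  assumes "v \<in> carrier_vec n" "x \<in> carrier_vec n"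
  shows "line_proj v *\<^sub>v x = ((x \<bullet>c v) / (v \<bullet>c v)) \<cdot>\<^sub>v v"
  using assms
  by (intro eq_vecI)
     (auto simp: line_proj_def scalar_prod_def sum_divide_distrib sum_distrib_right
           intro!: sum.cong)

lemma line_proj_orthogonal:
  assumes "v \<in> carrier_vec n" "x \<in> carrier_vec n" "v \<noteq> 0\<^sub>v n"
  shows "(x - line_proj v *\<^sub>v x) \<bullet>c v = 0"
proof -
  have "v \<bullet>c v \<noteq> 0"
    using assms by simp
  then show ?thesis
    using assms
    by (simp add: line_proj_mult_vec[OF assms(1,2)] minus_scalar_prod_distrib[where n = n])
qed

definition psi :: "real \<Rightarrow> nat \<Rightarrow> complex Matrix.vec" where
  "psi \<theta> j = (if j = 1
     then vec_of_list [complex_of_real (cos \<theta>), complex_of_real (sin \<theta>)]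
     else vec_of_list [complex_of_real (- sin \<theta>), complex_of_real (cos \<theta>)])"

definition psi_proj :: "real \<Rightarrow> nat \<Rightarrow> complex mat" where
  "psi_proj \<theta> j = line_proj (psi \<theta> j)"

text \<open>A word \<open>(j\<^sub>1, \<dots>, j\<^sub>n)\<close> is a list of length \<open>n\<close> with entries in \<open>{1, 2}\<close>. The values are
  real, but they are complex numbers by type as quotients of traces.\<close>

definition mu_beta :: "real \<Rightarrow> real \<Rightarrow> nat list \<Rightarrow> complex" where
  "mu_beta \<theta> \<beta> js =
     (let E = mat_exp (complex_of_real (- \<beta>) \<cdot>\<^sub>m H_chain (length js))
      in mat_trace (E * kronecker_list (map (psi_proj \<theta>) js)) / mat_trace E)"

definition mu_infty :: "real \<Rightarrow> nat list \<Rightarrow> complex" where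
  "mu_infty \<theta> js = Lim at_top (\<lambda>\<beta>. mu_beta \<theta> \<beta> js)"

text \<open>The coordinate \<open>x\<^sub>i\<close>, \<open>i \<ge> 1\<close>, of a point of \<open>\<Omega>\<close> is \<open>x (i - 1)\<close>.\<close>

definition Omega :: "(nat \<Rightarrow> nat) set" where
  "Omega = {x. \<forall>i. x i \<in> {1, 2}}"

definition shift :: "(nat \<Rightarrow> nat) \<Rightarrow> (nat \<Rightarrow> nat)" where
  "shift x = (\<lambda>i. x (Suc i))"

text \<open>Here \<open>borel\<close> comes from the product topology on \<open>nat \<Rightarrow> nat\<close> with discrete factors, whose
  trace on \<open>\<Omega>\<close> is the product topology of \<open>\<Omega>\<close>.\<close>

definition quantum_mu :: "real \<Rightarrow> (nat \<Rightarrow> nat) measure" where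
  "quantum_mu \<theta> = (THE \<mu>. prob_space \<mu> \<and> sets \<mu> = sets (restrict_space borel Omega) \<and>
     (\<forall>js. length js \<ge> 2 \<and> set js \<subseteq> {1, 2} \<longrightarrow>
        complex_of_real (measure \<mu> {x \<in> Omega. \<forall>i<length js. x i = js ! i}) = mu_infty \<theta> js))"

definition birkhoff_sum :: "((nat \<Rightarrow> nat) \<Rightarrow> real) \<Rightarrow> nat \<Rightarrow> (nat \<Rightarrow> nat) \<Rightarrow> real" where
  "birkhoff_sum A n x = (\<Sum>j<n. A ((shift ^^ j) x))"

definition ext_log :: "real \<Rightarrow> ereal" where
  "ext_log p = (if p = 0 then -\<infinity> else ereal (ln p))"

definition lower_semicontinuous :: "(real \<Rightarrow> ereal) \<Rightarrow> bool" where
  "lower_semicontinuous I \<longleftrightarrow> (\<forall>a. closed {s. I s \<le> a})"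

definition large_deviation_principle ::
    "(nat \<Rightarrow> nat) measure \<Rightarrow> ((nat \<Rightarrow> nat) \<Rightarrow> real) \<Rightarrow> bool" where
  "large_deviation_principle \<mu> A \<longleftrightarrow> (\<exists>I :: real \<Rightarrow> ereal.
     lower_semicontinuous I \<and> (\<forall>s. 0 \<le> I s) \<and>
     (\<forall>K. closed K \<longrightarrow>
        limsup (\<lambda>n. ereal (1 / real n) *
          ext_log (measure \<mu> {z \<in> space \<mu>. birkhoff_sum A n z / real n \<in> K})) \<le> - (INF s\<in>K. I s)) \<and>
     (\<forall>B. open B \<longrightarrow>
        liminf (\<lambda>n. ereal (1 / real n) *
          ext_log (measure \<mu> {z \<in> space \<mu>. birkhoff_sum A n z / real n \<in> B})) \<ge> - (INF s\<in>B. I s)))"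

end

theory Submission
  imports Defs "HOL-Real_Asymp.Real_Asymp"
begin

text \<open>
  Conjugation by the Hadamard matrix \<open>h\<close>, which satisfies \<open>h * h = 1\<close>, turns \<^const>\<open>sigma_x\<close> into
  \<open>diag(1, -1)\<close>. On the whole chain, conjugation by \<open>h \<otimes> \<dots> \<otimes> h\<close> therefore makes the Hamiltonian
  diagonal: on the basis vector labelled by a binary word it acts as the classical
  antiferromagnetic energy \<open>\<Sum> s\<^sub>i s\<^sub>i\<^sub>+\<^sub>1\<close> of the spins \<open>s\<^sub>i = \<plusminus>1\<close> coded by the word
  (\<open>H_chain_diagonal\<close>). Since a trace only sees diagonal entries, \<open>\<mu>\<^bsub>\<beta>,n\<^esub>\<close> is a
  classical Gibbs average (\<open>mu_beta_eq_gibbs_average\<close>), and as \<open>\<beta>\<close> tends to infinity it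
  concentrates on the words of minimal energy. These are the two alternating words, so that
  with \<open>p = (1 + sin 2\<theta>) / 2\<close> the limit is the even mixture of two product measures whose
  marginals alternate between \<open>(p, 1 - p)\<close> and \<open>(1 - p, p)\<close> (\<open>mu_infty_eq_alt_mixture\<close>). Such a mixture
  extends to a measure on \<open>\<Omega>\<close>, and this measure is determined by its cylinder masses, which
  identifies \<open>\<mu>\<close> (\<open>quantum_mu_properties\<close>).

  For a product measure the exponential moment of a sum over coordinates factorises. Put
  \<open>u = p e\<^bsup>t a 1\<^esup> + (1 - p) e\<^bsup>t a 2\<^esup>\<close> and
  \<open>v = (1 - p) e\<^bsup>t a 1\<^esup> + p e\<^bsup>t a 2\<^esup>\<close>. Up to a bounded factor, which only appears for odd \<open>n\<close>,
  the exponential moment of the Birkhoff sum is \<open>(u v)\<^bsup>n div 2\<^esup>\<close>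
  (\<open>exp_birkhoff_sum_integral\<close>). Hence the free energy is \<open>ln (u v) / 2\<close>, and expanding \<open>u v\<close> gives the
  formula.

  This free energy is differentiable on the whole line, so the large deviation principle is an
  instance of the Gaertner-Ellis theorem on the line, proved below for real random variables
  with finite exponential moments (\<open>large_deviations\<close>). The rate function is the Legendre
  transform of the free energy.
\<close>

section \<open>Large deviations from a differentiable free energy\<close>

lemma ext_log_le: "0 \<le> p \<Longrightarrow> p \<le> exp r \<Longrightarrow> ext_log p \<le> ereal r"
  unfolding ext_log_def using ln_le_cancel_iff[of p "exp r"] by auto

lemma le_ext_log: "exp r \<le> p \<Longrightarrow> ereal r \<le> ext_log p"
  unfolding ext_log_def using exp_gt_zero[of r] ln_mono[of "exp r" p] by (auto simp del: exp_gt_zero)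

lemma scaled_ext_log_le:
  assumes "0 < n" "0 \<le> p" "p \<le> exp (real n * s)"
  shows "ereal (1 / real n) * ext_log p \<le> ereal s"
proof -
  have "ereal (1 / real n) * ext_log p \<le> ereal (1 / real n) * ereal (real n * s)"
    by (intro ereal_mult_left_mono ext_log_le assms) auto
  then show ?thesis using assms by simp
qed

lemma le_scaled_ext_log:
  assumes "0 < n" "exp (real n * s) \<le> p"
  shows "ereal s \<le> ereal (1 / real n) * ext_log p"
proof -
  have "ereal (1 / real n) * ereal (real n * s) \<le> ereal (1 / real n) * ext_log p"
    by (intro ereal_mult_left_mono le_ext_log assms) auto
  then show ?thesis using assms by simp
qed

lemma eventually_const_le_exp:
  fixes C \<delta> :: real assumes "0 < \<delta>"
  shows "\<forall>\<^sub>F n in sequentially. C \<le> exp (real n * \<delta>)"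
proof -
  have "filterlim (\<lambda>n. exp (real n * \<delta>)) at_top sequentially"
    using assms by real_asymp
  then show ?thesis by (simp add: filterlim_at_top)
qed

definition legendre :: "(real \<Rightarrow> real) \<Rightarrow> real \<Rightarrow> ereal" where
  "legendre c x = (SUP t. ereal (t * x - c t))"

lemma legendre_ge: "ereal (t * x - c t) \<le> legendre c x"
  unfolding legendre_def by (rule SUP_upper) simp

lemma lower_semicontinuous_legendre: "lower_semicontinuous (legendre c)"
proof -
  have "{s. legendre c s \<le> a} = (\<Inter>t. {s. ereal (t * s - c t) \<le> a})" for a
    by (auto simp: legendre_def SUP_le_iff)
  moreover have "closed {s. ereal (t * s - c t) \<le> a}" for t a
    by (intro closed_Collect_le continuous_intros)
  ultimately show ?thesis
    unfolding lower_semicontinuous_def by (metis (no_types, lifting) closed_INT)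
qed

text \<open>
  The lower bound can be proved directly only at slopes \<open>y = c' t\<close>, where tilting by \<open>t\<close> makes \<open>y\<close>
  typical. Points with finite rate are approximated by slopes as follows: perturb the function
  \<open>t \<mapsto> t x - c t\<close>, whose supremum is the rate, by \<open>- \<delta> t\<^sup>2\<close>. A maximum \<open>t\<close> then exists and
  satisfies \<open>c' t = x - 2 \<delta> t\<close>. As the maximum is at least the value \<open>0\<close> at the origin,
  \<open>\<delta> t\<^sup>2\<close> is at most the rate at \<open>x\<close>, which makes \<open>2 \<delta> t\<close> small with \<open>\<delta>\<close>.
\<close>

lemma slope_near_finite_legendre:
  fixes c :: "real \<Rightarrow> real"
  assumes diff: "\<And>t. c differentiable (at t)" and c0: "c 0 = 0"
    and fin: "legendre c x \<le> ereal r" and "0 < \<epsilon>"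
  obtains t y where "(c has_real_derivative y) (at t)" "\<bar>y - x\<bar> < \<epsilon>" "t * y - c t \<le> r"
proof -
  have le_r: "t * x - c t \<le> r" for t
    using order_trans[OF legendre_ge fin, of t] by simp
  have r0: "0 \<le> r" using le_r[of 0] c0 by simp
  \<comment> \<open>Chosen so that \<open>(2 \<delta> t)\<^sup>2 = 4 \<delta> (\<delta> t\<^sup>2) \<le> 4 \<delta> r < \<epsilon>\<^sup>2\<close>.\<close>
  define \<delta> where "\<delta> = \<epsilon>\<^sup>2 / (4 * (r + 1))"
  have \<delta>: "0 < \<delta>" "4 * \<delta> * r < \<epsilon>\<^sup>2"
    using r0 \<open>0 < \<epsilon>\<close> by (auto simp: \<delta>_def field_simps)
  define f where "f t = t * x - c t - \<delta> * t\<^sup>2" for t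
  \<comment> \<open>Outside \<open>[-R, R]\<close> the quadratic term exceeds \<open>r\<close>, so \<open>f\<close> is negative there.\<close>
  define R where "R = r / \<delta> + 1"
  have R: "0 < R" "r < \<delta> * R\<^sup>2"
  proof -
    have "1 \<le> R" using r0 \<delta> by (simp add: R_def)
    then have "R \<le> R\<^sup>2" by (simp add: power2_eq_square)
    moreover have "r < \<delta> * R" using \<delta> by (simp add: R_def field_simps)
    ultimately show "0 < R" "r < \<delta> * R\<^sup>2"
      using \<open>1 \<le> R\<close> \<delta>(1) mult_left_mono[OF \<open>R \<le> R\<^sup>2\<close>, of \<delta>] by linarith+
  qed
  have cont: "continuous_on {-R..R} f"
    unfolding f_def
    using diff by (intro continuous_intros continuous_at_imp_continuous_on ballI differentiable_imp_continuous_within)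
  obtain t where t: "t \<in> {-R..R}" "\<And>s. s \<in> {-R..R} \<Longrightarrow> f s \<le> f t"
    using continuous_attains_sup[OF _ _ cont] R by fastforce
  have f0: "f 0 = 0" by (simp add: f_def c0)
  have ft: "0 \<le> f t" using t(2)[of 0] f0 R by simp
  have max: "f s \<le> f t" for s
  proof (cases "s \<in> {-R..R}")
    case False
    then have "R\<^sup>2 \<le> s\<^sup>2" using R by (intro abs_le_square_iff[THEN iffD1]) auto
    then have "\<delta> * R\<^sup>2 \<le> \<delta> * s\<^sup>2" using \<delta> by simp
    then show ?thesis using le_r[of s] R ft by (simp add: f_def)
  qed (rule t(2))
  obtain y where y: "(c has_real_derivative y) (at t)"
    using diff[of t] by (auto simp: real_differentiable_def)
  have "(f has_real_derivative (x - y - \<delta> * (2 * t))) (at t)"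
    unfolding f_def by (auto intro!: derivative_eq_intros y)
  then have "x - y - \<delta> * (2 * t) = 0"
    by (rule DERIV_local_max[where d = 1]) (auto simp: max)
  then have yx: "y = x - 2 * \<delta> * t" by simp
  have "\<delta> * t\<^sup>2 \<le> r" using ft le_r[of t] by (simp add: f_def)
  then have "4 * \<delta> * (\<delta> * t\<^sup>2) \<le> 4 * \<delta> * r" using \<delta> by simp
  moreover have "(y - x)\<^sup>2 = 4 * \<delta> * (\<delta> * t\<^sup>2)" by (simp add: yx power2_eq_square)
  ultimately have "(y - x)\<^sup>2 < \<epsilon>\<^sup>2" using \<delta>(2) by linarith
  then have "\<bar>y - x\<bar> < \<epsilon>"
    using \<open>0 < \<epsilon>\<close> by (metis abs_le_square_iff abs_of_pos linorder_not_le)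
  moreover have "t * y - c t = f t - \<delta> * t\<^sup>2"
    by (simp add: yx f_def power2_eq_square algebra_simps)
  then have "t * y - c t \<le> r"
    using le_r[of t] mult_nonneg_nonneg[of \<delta> "t\<^sup>2"] \<delta>(1) zero_le_power2[of t] unfolding f_def by linarith
  ultimately show ?thesis using that y by blast
qed

locale free_energy = prob_space M for M :: "'a measure" +
  fixes S :: "nat \<Rightarrow> 'a \<Rightarrow> real" and c :: "real \<Rightarrow> real"
  assumes meas [measurable]: "\<And>n. S n \<in> borel_measurable M"
    and integrable_exp: "\<And>n t. integrable M (\<lambda>x. exp (t * S n x))"
    and lim: "\<And>t. (\<lambda>n. 1 / real n * ln (\<integral>x. exp (t * S n x) \<partial>M)) \<longlonglongrightarrow> c t"
begin

definition mgf :: "real \<Rightarrow> nat \<Rightarrow> real" where "mgf t n = (\<integral>x. exp (t * S n x) \<partial>M)"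

lemma mgf_pos: "0 < mgf t n"
proof -
  have "0 \<le> mgf t n" unfolding mgf_def by simp
  moreover have "mgf t n \<noteq> 0"
  proof
    assume "mgf t n = 0"
    then have "AE x in M. exp (t * S n x) = 0"
      unfolding mgf_def by (subst (asm) integral_nonneg_eq_0_iff_AE) (auto simp: integrable_exp)
    then show False by (simp add: AE_False)
  qed
  ultimately show ?thesis by simp
qed

lemma zero_at_zero: "c 0 = 0"
proof -
  have "(\<lambda>n. 1 / real n * ln (\<integral>x. exp (0 * S n x) \<partial>M)) \<longlonglongrightarrow> 0"
    by (simp add: prob_space)
  then show ?thesis using lim[of 0] LIMSEQ_unique by blast
qed

lemma eventually_mgf_le:
  assumes "0 < \<eta>" shows "\<forall>\<^sub>F n in sequentially. mgf t n \<le> exp (real n * (c t + \<eta>))"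
proof -
  have "\<forall>\<^sub>F n in sequentially. 1 / real n * ln (mgf t n) < c t + \<eta>"
    using order_tendstoD(2)[OF lim[of t], of "c t + \<eta>"] assms by (simp add: mgf_def)
  with eventually_gt_at_top[of 0] show ?thesis
  proof eventually_elim
    case (elim n)
    then have "exp (ln (mgf t n)) \<le> exp (real n * (c t + \<eta>))" by (simp add: field_simps)
    then show ?case using mgf_pos[of t n] by simp
  qed
qed

lemma eventually_mgf_ge:
  assumes "0 < \<eta>" shows "\<forall>\<^sub>F n in sequentially. exp (real n * (c t - \<eta>)) \<le> mgf t n"
proof -
  have "\<forall>\<^sub>F n in sequentially. c t - \<eta> < 1 / real n * ln (mgf t n)"
    using order_tendstoD(1)[OF lim[of t], of "c t - \<eta>"] assms by (simp add: mgf_def)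
  with eventually_gt_at_top[of 0] show ?thesis
  proof eventually_elim
    case (elim n)
    then have "real n * (c t - \<eta>) \<le> ln (mgf t n)" by (simp add: field_simps)
    then show ?case using mgf_pos by (simp add: ln_ge_iff)
  qed
qed

lemma chernoff: "prob {x \<in> space M. a \<le> t * S n x} \<le> exp (- a) * mgf t n"
proof -
  have "prob {x \<in> space M. exp a \<le> exp (t * S n x)} \<le> (\<integral>x. exp (t * S n x) \<partial>M) / exp a"
    by (intro integral_Markov_inequality_measure[where A="{}"] integrable_exp) auto
  then show ?thesis by (simp add: mgf_def exp_minus field_simps)
qed

text \<open>
  Each set \<open>{y. m + c t < t * y}\<close> is a half line with probability of order at most
  \<open>e\<^bsup>- n m\<^esup>\<close> by Chernoff's bound, and finitely many of them only cost a constant factor.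
\<close>

lemma half_line_cover_upper_bound:
  assumes T: "finite T" and cover: "K \<subseteq> (\<Union>t\<in>T. {y. m + c t < t * y})" and "0 < \<eta>"
  shows "\<forall>\<^sub>F n in sequentially. ereal (1 / real n) * ext_log (prob {z \<in> space M. S n z / real n \<in> K})
           \<le> ereal (- m + \<eta>)"
proof -
  have "\<forall>\<^sub>F n in sequentially. \<forall>t\<in>T. mgf t n \<le> exp (real n * (c t + \<eta> / 2))"
    using T by (intro eventually_ball_finite ballI eventually_mgf_le) (use \<open>0 < \<eta>\<close> in auto)
  moreover have "\<forall>\<^sub>F n in sequentially. real (card T) \<le> exp (real n * (\<eta> / 2))"
    using \<open>0 < \<eta>\<close> by (intro eventually_const_le_exp) auto
  ultimately show ?thesis using eventually_gt_at_top[of 0]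
  proof eventually_elim
    case (elim n)
    have "prob {z \<in> space M. S n z / real n \<in> K}
        \<le> prob (\<Union>t\<in>T. {z \<in> space M. real n * (m + c t) \<le> t * S n z})"
    proof (intro finite_measure_mono subsetI)
      fix z assume z: "z \<in> {z \<in> space M. S n z / real n \<in> K}"
      then obtain t where t: "t \<in> T" "m + c t < t * (S n z / real n)" using cover by auto
      then have "real n * (m + c t) \<le> t * S n z" using elim(3) by (simp add: field_simps)
      then show "z \<in> (\<Union>t\<in>T. {z \<in> space M. real n * (m + c t) \<le> t * S n z})" using z t by auto
    qed (use T in auto)
    also have "\<dots> \<le> (\<Sum>t\<in>T. prob {z \<in> space M. real n * (m + c t) \<le> t * S n z})"
      using T by (intro finite_measure_subadditive_finite) auto
    also have "\<dots> \<le> (\<Sum>t\<in>T. exp (- (real n * (m + c t))) * mgf t n)"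
      by (intro sum_mono chernoff)
    also have "\<dots> \<le> (\<Sum>t\<in>T. exp (- (real n * (m + c t))) * exp (real n * (c t + \<eta> / 2)))"
      using elim(1) by (intro sum_mono mult_left_mono) auto
    also have "\<dots> = real (card T) * exp (real n * (- m + \<eta> / 2))"
      by (simp add: exp_add[symmetric] algebra_simps)
    also have "\<dots> \<le> exp (real n * (\<eta> / 2)) * exp (real n * (- m + \<eta> / 2))"
      using elim(2) by (intro mult_right_mono) auto
    also have "\<dots> = exp (real n * (- m + \<eta>))"
      by (simp add: exp_add[symmetric] algebra_simps)
    finally show ?case using elim(3) by (intro scaled_ext_log_le) auto
  qed
qed

text \<open>
  If \<open>m\<close> lies below the infimum of the rate function over \<open>K\<close>, then the half lines
  \<open>{y. m + c t < t * y}\<close> cover \<open>K\<close>. The two with \<open>t = 1\<close> and \<open>t = -1\<close> cover everything outside a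
  bounded interval, so finitely many suffice by compactness, even if \<open>K\<close> is unbounded.
\<close>

lemma upper_bound:
  assumes "closed K"
  shows "limsup (\<lambda>n. ereal (1 / real n) * ext_log (prob {z \<in> space M. S n z / real n \<in> K}))
    \<le> - (INF s\<in>K. legendre c s)" (is "limsup ?X \<le> _")
proof (rule ccontr)
  assume "\<not> ?thesis"
  then have "- limsup ?X < (INF s\<in>K. legendre c s)"
    by (simp add: not_le ereal_uminus_less_reorder)
  then obtain m where m: "- limsup ?X < ereal m" "ereal m < (INF s\<in>K. legendre c s)"
    using ereal_dense2 by blast
  define U where "U t = {y. m + c t < t * y}" for t
  have U_open: "open (U t)" for t
    unfolding U_def by (intro open_Collect_less continuous_intros)
  have "\<exists>t. x \<in> U t" if "x \<in> K" for x
  proof -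
    have "ereal m < legendre c x" using m(2) INF_lower[OF that] less_le_trans by blast
    then obtain t where "ereal m < ereal (t * x - c t)" unfolding legendre_def less_SUP_iff by blast
    then have "x \<in> U t" by (simp add: U_def)
    then show ?thesis ..
  qed
  then have "K \<inter> {-(m + c (-1))..m + c 1} \<subseteq> (\<Union>t\<in>UNIV. U t)" by auto
  then obtain T where T: "finite T" "K \<inter> {-(m + c (-1))..m + c 1} \<subseteq> (\<Union>t\<in>T. U t)"
    using compactE_image[of "K \<inter> {-(m + c (-1))..m + c 1}" UNIV U] U_open
      closed_Int_compact[OF \<open>closed K\<close> compact_Icc] by metis
  have cover: "K \<subseteq> (\<Union>t\<in>insert 1 (insert (-1) T). U t)"
  proof
    fix x assume "x \<in> K"
    show "x \<in> (\<Union>t\<in>insert 1 (insert (-1) T). U t)"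
    proof (cases "x \<in> {-(m + c (-1))..m + c 1}")
      case True then show ?thesis using T(2) \<open>x \<in> K\<close> by auto
    next
      case False then show ?thesis by (auto simp: U_def not_le)
    qed
  qed
  have "limsup ?X \<le> ereal (- m) + ereal \<eta>" if "0 < \<eta>" for \<eta>
    using half_line_cover_upper_bound[OF _ cover[unfolded U_def] that] T(1)
    by (auto intro!: Limsup_bounded)
  then have "limsup ?X \<le> ereal (- m)"
    by (rule ereal_le_epsilon2) auto
  then have "ereal m \<le> - limsup ?X"
    using ereal_minus_le_minus[of "- limsup ?X" "ereal m"] by simp
  then show False using m(1) by simp
qed

text \<open>
  Under the measure with density proportional to \<open>e\<^bsup>t S\<^sub>n\<^esup>\<close> the averages concentrate at the
  slope \<open>y\<close> of \<open>c\<close> at \<open>t\<close>: the contributions of \<open>S\<^sub>n \<ge> n (y + \<epsilon>)\<close> and \<open>S\<^sub>n \<le> n (y - \<epsilon>)\<close>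
  to the exponential moment at \<open>t\<close> are bounded by the moments at \<open>t + \<delta>\<close> and \<open>t - \<delta>\<close>, and
  differentiability at \<open>t\<close> makes these bounds exponentially smaller than the whole moment.
  On the remaining event \<open>e\<^bsup>t S\<^sub>n\<^esup>\<close> is at most
  \<open>e\<^bsup>n (t y + \<bar>t\<bar> \<epsilon>)\<^esup>\<close>, which bounds the probability of this event from below.
\<close>

lemma tilted_lower_bound:
  assumes der: "(c has_real_derivative y) (at t)" and "0 < \<epsilon>" "0 < \<eta>"
  shows "\<forall>\<^sub>F n in sequentially. exp (real n * (c t - t * y - \<bar>t\<bar> * \<epsilon> - \<eta>))
           \<le> prob {z \<in> space M. \<bar>S n z / real n - y\<bar> < \<epsilon>}"
proof -
  obtain \<delta> where \<delta>: "0 < \<delta>" "c (t + \<delta>) \<le> c t + \<delta> * (y + \<epsilon> / 2)" "c (t - \<delta>) \<le> c t - \<delta> * (y - \<epsilon> / 2)"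
  proof -
    have lim0: "((\<lambda>h. (c (t + h) - c t) / h) \<longlongrightarrow> y) (at 0)"
      using der by (simp add: DERIV_def)
    have "\<forall>\<^sub>F h in at 0. dist ((c (t + h) - c t) / h) y < \<epsilon> / 2"
      using tendstoD[OF lim0, of "\<epsilon> / 2"] \<open>0 < \<epsilon>\<close> by simp
    then obtain d where d: "0 < d"
      "\<And>h. h \<noteq> 0 \<Longrightarrow> \<bar>h\<bar> < d \<Longrightarrow> \<bar>(c (t + h) - c t) / h - y\<bar> < \<epsilon> / 2"
      by (auto simp: eventually_at dist_real_def)
    define \<delta> where "\<delta> = d / 2"
    have 0: "0 < \<delta>" using d by (simp add: \<delta>_def)
    have "\<bar>(c (t + \<delta>) - c t) / \<delta> - y\<bar> < \<epsilon> / 2" "\<bar>(c (t + - \<delta>) - c t) / - \<delta> - y\<bar> < \<epsilon> / 2"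
      using d(1) by (intro d(2); simp add: \<delta>_def)+
    then have "(c (t + \<delta>) - c t) / \<delta> \<le> y + \<epsilon> / 2" "y - \<epsilon> / 2 \<le> (c (t + - \<delta>) - c t) / - \<delta>"
      by linarith+
    then show ?thesis using that[of \<delta>] 0 by (auto simp: field_simps)
  qed
  \<comment> \<open>Per unit of \<open>n\<close> the exponents of the tails lie \<open>\<delta> \<epsilon> / 2 = 4 \<kappa>\<close> below \<open>c t\<close>, so that errors of
  \<open>\<kappa>\<close> in each of the three moments leave the tails exponentially smaller.\<close>
  define \<kappa> where "\<kappa> = \<delta> * \<epsilon> / 8"
  have \<kappa>: "0 < \<kappa>" using \<delta> \<open>0 < \<epsilon>\<close> by (simp add: \<kappa>_def)
  have ev: "\<forall>\<^sub>F n in sequentially. mgf (t + \<delta>) n \<le> exp (real n * (c (t + \<delta>) + \<kappa>))"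
    "\<forall>\<^sub>F n in sequentially. mgf (t - \<delta>) n \<le> exp (real n * (c (t - \<delta>) + \<kappa>))"
    "\<forall>\<^sub>F n in sequentially. exp (real n * (c t - \<kappa>)) \<le> mgf t n"
    "\<forall>\<^sub>F n in sequentially. exp (real n * (c t - \<eta> / 2)) \<le> mgf t n"
    "\<forall>\<^sub>F n in sequentially. 4 \<le> exp (real n * \<kappa>)"
    "\<forall>\<^sub>F n in sequentially. 2 \<le> exp (real n * (\<eta> / 2))"
    by (intro eventually_mgf_le eventually_mgf_ge eventually_const_le_exp; use \<kappa> \<open>0 < \<eta>\<close> in simp)+
  show ?thesis using ev eventually_gt_at_top[of 0]
  proof eventually_elim
    case (elim n)
    define G where "G = {z \<in> space M. \<bar>S n z / real n - y\<bar> < \<epsilon>}"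
    have G [measurable]: "G \<in> events" unfolding G_def by measurable
    define F\<^sub>0 where "F\<^sub>0 z = exp (real n * (t * y + \<bar>t\<bar> * \<epsilon>)) * indicator G z" for z
    define F\<^sub>1 where "F\<^sub>1 z = exp (- (real n * \<delta> * (y + \<epsilon>))) * exp ((t + \<delta>) * S n z)" for z
    define F\<^sub>2 where "F\<^sub>2 z = exp (real n * \<delta> * (y - \<epsilon>)) * exp ((t - \<delta>) * S n z)" for z
    have nonneg: "0 \<le> F\<^sub>0 z" "0 \<le> F\<^sub>1 z" "0 \<le> F\<^sub>2 z" for z
      by (auto simp: F\<^sub>0_def F\<^sub>1_def F\<^sub>2_def)
    have pointwise: "exp (t * S n z) \<le> F\<^sub>0 z + F\<^sub>1 z + F\<^sub>2 z" if z: "z \<in> space M" for z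
    proof (cases "z \<in> G")
      case True
      define d where "d = S n z / real n - y"
      have d: "\<bar>d\<bar> \<le> \<epsilon>" "S n z = real n * (y + d)"
        using True \<open>0 < n\<close> by (auto simp: G_def d_def)
      have "t * d \<le> \<bar>t\<bar> * \<bar>d\<bar>" by (metis abs_ge_self abs_mult)
      also have "\<dots> \<le> \<bar>t\<bar> * \<epsilon>" using d(1) by (rule mult_left_mono) simp
      finally have "real n * (t * y + t * d) \<le> real n * (t * y + \<bar>t\<bar> * \<epsilon>)"
        by (intro mult_left_mono) auto
      then have "t * S n z \<le> real n * (t * y + \<bar>t\<bar> * \<epsilon>)" by (simp add: d(2) algebra_simps)
      then have "exp (t * S n z) \<le> F\<^sub>0 z" using True by (simp add: F\<^sub>0_def)
      then show ?thesis using nonneg[of z] by linarith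
    next
      case False
      then have "\<epsilon> \<le> \<bar>S n z / real n - y\<bar>" using z by (simp add: G_def)
      then have "y + \<epsilon> \<le> S n z / real n \<or> S n z / real n \<le> y - \<epsilon>" by linarith
      then consider "real n * (y + \<epsilon>) \<le> S n z" | "S n z \<le> real n * (y - \<epsilon>)"
        using \<open>0 < n\<close> by (auto simp: pos_le_divide_eq pos_divide_le_eq mult.commute)
      then show ?thesis
      proof cases
        case 1
        then have "\<delta> * (real n * (y + \<epsilon>)) \<le> \<delta> * S n z" using \<delta>(1) by (intro mult_left_mono) auto
        then have "exp (t * S n z) \<le> F\<^sub>1 z"
          unfolding F\<^sub>1_def exp_add[symmetric] by (simp add: algebra_simps)
        then show ?thesis using nonneg[of z] by linarith
      next
        case 2
        then have "\<delta> * S n z \<le> \<delta> * (real n * (y - \<epsilon>))" using \<delta>(1) by (intro mult_left_mono) auto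
        then have "exp (t * S n z) \<le> F\<^sub>2 z"
          unfolding F\<^sub>2_def exp_add[symmetric] by (simp add: algebra_simps)
        then show ?thesis using nonneg[of z] by linarith
      qed
    qed
    have int: "integrable M F\<^sub>0" "integrable M F\<^sub>1" "integrable M F\<^sub>2"
      unfolding F\<^sub>0_def F\<^sub>1_def F\<^sub>2_def using G
      by (auto intro!: integrable_mult_right integrable_exp simp: emeasure_eq_measure)
    have "mgf t n \<le> (\<integral>z. F\<^sub>0 z + F\<^sub>1 z + F\<^sub>2 z \<partial>M)"
      unfolding mgf_def using int pointwise by (intro integral_mono integrable_exp) auto
    also have "\<dots> = (\<integral>z. F\<^sub>0 z \<partial>M) + (\<integral>z. F\<^sub>1 z \<partial>M) + (\<integral>z. F\<^sub>2 z \<partial>M)"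
      using int by simp
    also have "\<dots> = exp (real n * (t * y + \<bar>t\<bar> * \<epsilon>)) * prob G
        + exp (- (real n * \<delta> * (y + \<epsilon>))) * mgf (t + \<delta>) n + exp (real n * \<delta> * (y - \<epsilon>)) * mgf (t - \<delta>) n"
      unfolding F\<^sub>0_def F\<^sub>1_def F\<^sub>2_def mgf_def using sets.sets_into_space[OF G] by (simp add: Int_absorb2)
    finally have main: "mgf t n \<le> \<dots>" .
    have "exp (- (real n * \<delta> * (y + \<epsilon>))) * mgf (t + \<delta>) n
        \<le> exp (- (real n * \<delta> * (y + \<epsilon>))) * exp (real n * (c (t + \<delta>) + \<kappa>))"
      using elim by (intro mult_left_mono) auto
    also have "\<dots> \<le> exp (real n * (c t - 2 * \<kappa>))"
    proof -
      have "- (\<delta> * (y + \<epsilon>)) + (c (t + \<delta>) + \<kappa>) \<le> c t - 2 * \<kappa>"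
        using \<delta> \<kappa> by (simp add: \<kappa>_def algebra_simps)
      from mult_left_mono[OF this, of "real n"] show ?thesis
        by (simp add: exp_add[symmetric] algebra_simps)
    qed
    finally have r1: "exp (- (real n * \<delta> * (y + \<epsilon>))) * mgf (t + \<delta>) n \<le> exp (real n * (c t - 2 * \<kappa>))" .
    have "exp (real n * \<delta> * (y - \<epsilon>)) * mgf (t - \<delta>) n
        \<le> exp (real n * \<delta> * (y - \<epsilon>)) * exp (real n * (c (t - \<delta>) + \<kappa>))"
      using elim by (intro mult_left_mono) auto
    also have "\<dots> \<le> exp (real n * (c t - 2 * \<kappa>))"
    proof -
      have "\<delta> * (y - \<epsilon>) + (c (t - \<delta>) + \<kappa>) \<le> c t - 2 * \<kappa>"
        using \<delta> \<kappa> by (simp add: \<kappa>_def algebra_simps)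
      from mult_left_mono[OF this, of "real n"] show ?thesis
        by (simp add: exp_add[symmetric] algebra_simps)
    qed
    finally have r2: "exp (real n * \<delta> * (y - \<epsilon>)) * mgf (t - \<delta>) n \<le> exp (real n * (c t - 2 * \<kappa>))" .
    have "4 * exp (real n * (c t - 2 * \<kappa>)) \<le> exp (real n * \<kappa>) * exp (real n * (c t - 2 * \<kappa>))"
      using elim by (intro mult_right_mono) auto
    also have "\<dots> = exp (real n * (c t - \<kappa>))" by (simp add: exp_add[symmetric] algebra_simps)
    finally have r3: "4 * exp (real n * (c t - 2 * \<kappa>)) \<le> mgf t n" using elim by simp
    have G_ge: "mgf t n / 2 \<le> exp (real n * (t * y + \<bar>t\<bar> * \<epsilon>)) * prob G"
      using main r1 r2 r3 by linarith
    have "2 * exp (real n * (c t - \<eta>)) \<le> exp (real n * (\<eta> / 2)) * exp (real n * (c t - \<eta>))"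
      using elim by (intro mult_right_mono) auto
    also have "\<dots> = exp (real n * (c t - \<eta> / 2))" by (simp add: exp_add[symmetric] algebra_simps)
    finally have "exp (real n * (c t - \<eta>)) \<le> exp (real n * (t * y + \<bar>t\<bar> * \<epsilon>)) * prob G"
      using G_ge elim by linarith
    then have "exp (- (real n * (t * y + \<bar>t\<bar> * \<epsilon>))) * exp (real n * (c t - \<eta>))
        \<le> exp (- (real n * (t * y + \<bar>t\<bar> * \<epsilon>))) * (exp (real n * (t * y + \<bar>t\<bar> * \<epsilon>)) * prob G)"
      by (rule mult_left_mono) simp
    also have "\<dots> = prob G" by (simp only: mult.assoc[symmetric] exp_add[symmetric]) simp
    finally have "exp (- (real n * (t * y + \<bar>t\<bar> * \<epsilon>))) * exp (real n * (c t - \<eta>)) \<le> prob G" .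
    then show ?case unfolding G_def exp_add[symmetric] by (simp add: algebra_simps)
  qed
qed

lemma lower_bound_at_slope:
  assumes der: "(c has_real_derivative y) (at t)" and "open B" "y \<in> B"
  shows "ereal (c t - t * y)
    \<le> liminf (\<lambda>n. ereal (1 / real n) * ext_log (prob {z \<in> space M. S n z / real n \<in> B}))" (is "_ \<le> liminf ?X")
proof -
  have "ereal (c t - t * y - \<eta>) \<le> liminf ?X" if "0 < \<eta>" for \<eta>
  proof -
    obtain e where e: "0 < e" "ball y e \<subseteq> B" using \<open>open B\<close> \<open>y \<in> B\<close> open_contains_ball by blast
    define \<epsilon> where "\<epsilon> = min e (\<eta> / (2 * (\<bar>t\<bar> + 1)))"
    have \<epsilon>: "0 < \<epsilon>" "\<epsilon> \<le> e" using e that by (auto simp: \<epsilon>_def)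
    have "\<bar>t\<bar> * \<epsilon> \<le> (\<bar>t\<bar> + 1) * (\<eta> / (2 * (\<bar>t\<bar> + 1)))"
      using \<epsilon> by (intro mult_mono) (auto simp: \<epsilon>_def)
    also have "\<dots> = \<eta> / 2" by (simp add: divide_simps)
    finally have te: "\<bar>t\<bar> * \<epsilon> \<le> \<eta> / 2" .
    have "\<forall>\<^sub>F n in sequentially. ereal (c t - t * y - \<eta>) \<le> ?X n"
      using tilted_lower_bound[OF der \<epsilon>(1) half_gt_zero[OF that]] eventually_gt_at_top[of 0]
    proof eventually_elim
      case (elim n)
      have "exp (real n * (c t - t * y - \<eta>)) \<le> exp (real n * (c t - t * y - \<bar>t\<bar> * \<epsilon> - \<eta> / 2))"
        using te by (simp add: mult_left_mono)
      also note elim(1)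
      also have "prob {z \<in> space M. \<bar>S n z / real n - y\<bar> < \<epsilon>} \<le> prob {z \<in> space M. S n z / real n \<in> B}"
      proof (intro finite_measure_mono subsetI)
        show "{z \<in> space M. S n z / real n \<in> B} \<in> events"
          using measurable_sets[of "\<lambda>z. S n z / real n" M borel B] \<open>open B\<close>
          by (simp add: vimage_def Int_def conj_commute)
        fix z assume "z \<in> {z \<in> space M. \<bar>S n z / real n - y\<bar> < \<epsilon>}"
        moreover from this have "S n z / real n \<in> ball y e"
          using \<epsilon> by (auto simp: dist_real_def)
        ultimately show "z \<in> {z \<in> space M. S n z / real n \<in> B}" using e by auto
      qed
      finally show ?case using elim(2) by (intro le_scaled_ext_log) auto
    qed
    then show ?thesis by (intro Liminf_bounded)
  qed
  then have "ereal (c t - t * y - \<eta>) + ereal \<eta> \<le> liminf ?X + ereal \<eta>" if "0 < \<eta>" for \<eta>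
    using that by (intro add_right_mono) auto
  then have "ereal (c t - t * y) \<le> liminf ?X + ereal \<eta>" if "0 < \<eta>" for \<eta>
    using that by simp
  then show ?thesis by (rule ereal_le_epsilon2) auto
qed

text \<open>
  The Gaertner-Ellis theorem on the line. For the lower bound on an open set only its points of
  finite rate matter, and near each of them there is a slope of \<open>c\<close> at which tilting gives a
  bound that is at least as good.
\<close>

theorem large_deviations:
  assumes diff: "\<And>t. c differentiable (at t)"
  shows "\<exists>I. lower_semicontinuous I \<and> (\<forall>s. 0 \<le> I s) \<and>
     (\<forall>K. closed K \<longrightarrow> limsup (\<lambda>n. ereal (1 / real n) *
          ext_log (prob {z \<in> space M. S n z / real n \<in> K})) \<le> - (INF s\<in>K. I s)) \<and>
     (\<forall>B. open B \<longrightarrow> liminf (\<lambda>n. ereal (1 / real n) *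
          ext_log (prob {z \<in> space M. S n z / real n \<in> B})) \<ge> - (INF s\<in>B. I s))"
proof (intro exI[of _ "legendre c"] conjI allI impI lower_semicontinuous_legendre upper_bound)
  show nonneg: "0 \<le> legendre c s" for s
    using legendre_ge[of 0 s c] by (simp only: mult_zero_left zero_at_zero diff_self zero_ereal_def)
  fix B :: "real set" assume "open B"
  define X where "X = liminf (\<lambda>n. ereal (1 / real n) * ext_log (prob {z \<in> space M. S n z / real n \<in> B}))"
  have "- X \<le> legendre c x" if x: "x \<in> B" for x
  proof (cases "legendre c x")
    case (real r)
    obtain e where e: "0 < e" "ball x e \<subseteq> B" using \<open>open B\<close> x open_contains_ball by blast
    obtain t y where ty: "(c has_real_derivative y) (at t)" "\<bar>y - x\<bar> < e" "t * y - c t \<le> r"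
      using slope_near_finite_legendre[OF diff zero_at_zero _ e(1)] real by (metis order_refl)
    have "y \<in> B" using ty(2) e(2) by (auto simp: dist_real_def)
    have "ereal (- r) \<le> ereal (c t - t * y)" using ty by simp
    also have "\<dots> \<le> X" unfolding X_def by (rule lower_bound_at_slope[OF ty(1) \<open>open B\<close> \<open>y \<in> B\<close>])
    finally have "- ereal r \<le> X" by simp
    then show ?thesis unfolding real by (rule ereal_uminus_le_reorder[THEN iffD1])
  qed (use nonneg[of x] in auto)
  then have "- X \<le> (INF s\<in>B. legendre c s)" by (intro INF_greatest)
  then show "- (INF s\<in>B. legendre c s)
      \<le> liminf (\<lambda>n. ereal (1 / real n) * ext_log (prob {z \<in> space M. S n z / real n \<in> B}))"
    unfolding X_def by (rule ereal_uminus_le_reorder[THEN iffD1])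
qed

end

section \<open>Words and cylinder sets\<close>

definition words :: "'a set \<Rightarrow> nat \<Rightarrow> 'a list set" where
  "words A n = {w. set w \<subseteq> A \<and> length w = n}"

lemma finite_words: "finite A \<Longrightarrow> finite (words A n)"
  unfolding words_def by (rule finite_lists_length_eq)

text \<open>
  Expanding a product of sums: a word selects one summand from each factor.
\<close>

lemma sum_words_prod:
  fixes f :: "nat \<Rightarrow> 'a \<Rightarrow> 'b :: comm_semiring_1"
  assumes "finite A"
  shows "(\<Sum>w\<in>words A n. \<Prod>i<n. f i (w ! i)) = (\<Prod>i<n. \<Sum>k\<in>A. f i k)"
proof (induction n arbitrary: f)
  case 0
  then show ?case by (simp add: words_def cong: conj_cong)
next
  case (Suc n)
  have "words A (Suc n) = (\<lambda>(w, k). k # w) ` (words A n \<times> A)"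
    unfolding words_def by (rule lists_length_Suc_eq)
  then have "(\<Sum>w\<in>words A (Suc n). \<Prod>i<Suc n. f i (w ! i))
      = (\<Sum>(w, k)\<in>words A n \<times> A. \<Prod>i<Suc n. f i ((k # w) ! i))"
    by (simp only:, subst sum.reindex) (auto simp: inj_on_def case_prod_beta)
  also have "\<dots> = (\<Sum>(w, k)\<in>words A n \<times> A. f 0 k * (\<Prod>i<n. f (Suc i) (w ! i)))"
    by (simp add: prod.lessThan_Suc_shift case_prod_beta del: prod.lessThan_Suc)
  also have "\<dots> = (\<Sum>w\<in>words A n. \<Sum>k\<in>A. f 0 k * (\<Prod>i<n. f (Suc i) (w ! i)))"
    by (simp add: sum.cartesian_product)
  also have "\<dots> = (\<Sum>w\<in>words A n. (\<Prod>i<n. f (Suc i) (w ! i))) * (\<Sum>k\<in>A. f 0 k)"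
    by (simp add: sum_distrib_left sum_distrib_right mult.commute)
  also have "\<dots> = (\<Prod>i<Suc n. \<Sum>k\<in>A. f i k)"
    by (simp add: Suc.IH[of "\<lambda>i. f (Suc i)"] prod.lessThan_Suc_shift mult.commute del: prod.lessThan_Suc)
  finally show ?case .
qed

definition cylinder :: "nat list \<Rightarrow> (nat \<Rightarrow> nat) set" where
  "cylinder js = {x \<in> Omega. \<forall>i<length js. x i = js ! i}"

definition Omega_borel :: "(nat \<Rightarrow> nat) measure" where
  "Omega_borel = restrict_space borel Omega"

lemma space_Omega_borel [simp]: "space Omega_borel = Omega"
  by (simp add: Omega_borel_def space_restrict_space)

text \<open>
  The Borel sets of the product topology are the product \<open>\<sigma>\<close>-algebra, because there are only
  countably many factors and each is discrete and countable.
\<close>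

lemma sets_borel_sequences:
  "sets (borel :: (nat \<Rightarrow> nat) measure) = sets (\<Pi>\<^sub>M i\<in>UNIV. count_space UNIV)"
proof -
  have "sets (\<Pi>\<^sub>M i\<in>(UNIV :: nat set). count_space (UNIV :: nat set)) = sets (\<Pi>\<^sub>M i\<in>UNIV. borel)"
    by (intro sets_PiM_cong) (auto simp: sets_borel_eq_count_space)
  then show ?thesis by (simp add: sets_PiM_equal_borel)
qed

lemma measurable_Omega_borel_iff:
  assumes "X \<in> space M \<rightarrow> Omega"
  shows "X \<in> measurable M Omega_borel \<longleftrightarrow> (\<forall>i. (\<lambda>w. X w i) \<in> measurable M (count_space UNIV))"
proof -
  have "X \<in> measurable M Omega_borel \<longleftrightarrow> X \<in> measurable M borel"
    unfolding Omega_borel_def using assms by (simp add: measurable_restrict_space2_iff)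
  also have "\<dots> \<longleftrightarrow> X \<in> measurable M (\<Pi>\<^sub>M i\<in>UNIV. count_space UNIV)"
    by (simp only: measurable_cong_sets[OF refl sets_borel_sequences])
  also have "\<dots> \<longleftrightarrow> (\<forall>i. (\<lambda>w. X w i) \<in> measurable M (count_space UNIV))"
  proof
    assume "X \<in> measurable M (\<Pi>\<^sub>M i\<in>UNIV. count_space UNIV)"
    then show "\<forall>i. (\<lambda>w. X w i) \<in> measurable M (count_space UNIV)"
      by (auto intro: measurable_compose[OF _ measurable_component_singleton])
  next
    assume "\<forall>i. (\<lambda>w. X w i) \<in> measurable M (count_space UNIV)"
    then show "X \<in> measurable M (\<Pi>\<^sub>M i\<in>UNIV. count_space UNIV)"
      by (intro measurable_PiM_single') auto
  qed
  finally show ?thesis .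
qed

lemma measurable_coordinate [measurable]: "(\<lambda>x. x i) \<in> measurable Omega_borel (count_space UNIV)"
  using measurable_Omega_borel_iff[of "\<lambda>x. x" Omega_borel] measurable_ident_sets[OF refl, of Omega_borel]
  by (simp add: Pi_I)

lemma cylinder_measurable: "cylinder js \<in> sets Omega_borel"
proof -
  have "{x \<in> space Omega_borel. \<forall>i<length js. x i = js ! i} \<in> sets Omega_borel"
    by measurable
  then show ?thesis by (simp only: cylinder_def space_Omega_borel)
qed

lemma cylinder_words:
  assumes "w \<in> words {1, 2} n"
  shows "cylinder w = {x \<in> Omega. map x [0..<n] = w}"
proof -
  have len: "length w = n" using assms by (simp add: words_def)
  have "(\<forall>i<length w. x i = w ! i) \<longleftrightarrow> map x [0..<n] = w" for x
    unfolding list_eq_iff_nth_eq using len by simp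
  then show ?thesis by (simp add: cylinder_def)
qed

lemma prefix_in_words: "x \<in> Omega \<Longrightarrow> map x [0..<n] \<in> words {1, 2} n"
  unfolding words_def Omega_def by fastforce

lemma cylinder_inter:
  assumes "length u \<le> length v"
  shows "cylinder u \<inter> cylinder v = (if \<forall>i<length u. u ! i = v ! i then cylinder v else {})"
proof (cases "\<forall>i<length u. u ! i = v ! i")
  case True
  then have "cylinder v \<subseteq> cylinder u" using assms unfolding cylinder_def by force
  then show ?thesis using True by auto
next
  case False
  then obtain i where i: "i < length u" "u ! i \<noteq> v ! i" by blast
  have False if "x \<in> cylinder u" "x \<in> cylinder v" for x
  proof -
    have "x i = u ! i" "x i = v ! i" using that i(1) assms by (simp_all add: cylinder_def)
    then show False using i(2) by simp
  qed
  then show ?thesis using False by auto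
qed

text \<open>
  The cylinders of length at least two already generate, since a condition on a single coordinate
  is a finite union of longer cylinders. The length restriction matches the range of \<open>n\<close> in which
  \<^const>\<open>mu_infty\<close> prescribes cylinder masses. The empty set is added for closure under
  intersections.
\<close>

lemma sets_Omega_borel_cylinders:
  "sets Omega_borel = sigma_sets Omega (insert {} (cylinder ` {js. 2 \<le> length js \<and> set js \<subseteq> {1, 2}}))"
  (is "_ = sigma_sets Omega ?E")
proof
  have E_sub: "?E \<subseteq> Pow Omega" by (auto simp: cylinder_def)
  show "sigma_sets Omega ?E \<subseteq> sets Omega_borel"
    using sets.sigma_sets_subset[of ?E Omega_borel] cylinder_measurable by auto
  let ?S = "sigma Omega ?E"
  have "(\<lambda>x. x i) \<in> measurable ?S (count_space UNIV)" for i
  proof (rule measurable_count_space_eq2_countable[THEN iffD2], intro conjI ballI)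
    fix k :: nat
    let ?W = "{w \<in> words {1, 2} (i + 2). w ! i = k}"
    have "(\<lambda>x. x i) -` {k} \<inter> space ?S = (\<Union>w\<in>?W. cylinder w)"
    proof (intro equalityI subsetI)
      fix x assume "x \<in> (\<lambda>x. x i) -` {k} \<inter> space ?S"
      then have "x \<in> Omega" "x i = k" by (auto simp: space_measure_of_conv)
      then have "map x [0..<i + 2] \<in> ?W" "x \<in> cylinder (map x [0..<i + 2])"
        using prefix_in_words[of x "i + 2"] by (auto simp: cylinder_def nth_append simp del: upt_Suc)
      then show "x \<in> (\<Union>w\<in>?W. cylinder w)" by blast
    next
      fix x assume "x \<in> (\<Union>w\<in>?W. cylinder w)"
      then show "x \<in> (\<lambda>x. x i) -` {k} \<inter> space ?S"
        by (auto simp: cylinder_def words_def space_measure_of_conv)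
    qed
    also have "\<dots> \<in> sets ?S"
    proof (rule sets.finite_UN)
      show "finite ?W" by (simp add: finite_words)
      fix w assume "w \<in> ?W"
      then have "cylinder w \<in> ?E" by (auto simp: words_def)
      then show "cylinder w \<in> sets ?S" using E_sub by (simp only: sets_measure_of sigma_sets.Basic)
    qed
    finally show "(\<lambda>x. x i) -` {k} \<inter> space ?S \<in> sets ?S" .
  qed auto
  then have "(\<lambda>x. x) \<in> measurable ?S Omega_borel"
    by (subst measurable_Omega_borel_iff) (auto simp: space_measure_of_conv)
  then have id: "(\<lambda>x. x) -` X \<inter> space ?S \<in> sets ?S" if "X \<in> sets Omega_borel" for X
    using that by (rule measurable_sets)
  show "sets Omega_borel \<subseteq> sigma_sets Omega ?E"
  proof
    fix X assume X: "X \<in> sets Omega_borel"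
    then have "X \<subseteq> Omega" using sets.sets_into_space by fastforce
    then show "X \<in> sigma_sets Omega ?E"
      using id[OF X] E_sub by (simp add: space_measure_of_conv Int_absorb2)
  qed
qed

lemma measure_eq_if_cylinders_eq:
  assumes "prob_space \<mu>" "sets \<mu> = sets Omega_borel" "prob_space \<nu>" "sets \<nu> = sets Omega_borel"
    and eq: "\<And>js. 2 \<le> length js \<Longrightarrow> set js \<subseteq> {1, 2} \<Longrightarrow> measure \<mu> (cylinder js) = measure \<nu> (cylinder js)"
  shows "\<mu> = \<nu>"
proof -
  interpret \<mu>: prob_space \<mu> by fact
  interpret \<nu>: prob_space \<nu> by fact
  let ?E = "insert {} (cylinder ` {js. 2 \<le> length js \<and> set js \<subseteq> {1, 2}})"
  let ?A = "cylinder ` words {1, 2} 2"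
  have stable: "Int_stable ?E"
  proof -
    have "cylinder u \<inter> cylinder v \<in> ?E"
      if "u \<in> {js. 2 \<le> length js \<and> set js \<subseteq> {1, 2}}" "v \<in> {js. 2 \<le> length js \<and> set js \<subseteq> {1, 2}}" for u v
    proof (cases "length u \<le> length v")
      case True
      then show ?thesis using cylinder_inter[of u v] that by auto
    next
      case False
      then show ?thesis using cylinder_inter[of v u] that by (auto simp: Int_commute)
    qed
    then show ?thesis unfolding Int_stable_def by auto
  qed
  have eq_E: "emeasure \<mu> X = emeasure \<nu> X" if "X \<in> ?E" for X
    using that eq by (auto simp: \<mu>.emeasure_eq_measure \<nu>.emeasure_eq_measure)
  have cover: "\<Union> ?A = Omega"
  proof
    show "Omega \<subseteq> \<Union> (cylinder ` words {1, 2} 2)"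
    proof
      fix x assume "x \<in> Omega"
      then have "map x [0..<2] \<in> words {1, 2} 2" "x \<in> cylinder (map x [0..<2])"
        using prefix_in_words[of x 2] by (auto simp: cylinder_def)
      then show "x \<in> \<Union> (cylinder ` words {1, 2} 2)" by blast
    qed
  qed (auto simp: cylinder_def)
  have "countable ?A" by (intro countable_finite finite_imageI finite_words) simp
  moreover have "?A \<subseteq> ?E" by (auto simp: words_def)
  moreover have "?E \<subseteq> Pow Omega" by (auto simp: cylinder_def)
  moreover have "sets \<mu> = sigma_sets Omega ?E" "sets \<nu> = sigma_sets Omega ?E"
    using assms sets_Omega_borel_cylinders by simp_all
  ultimately show ?thesis
    using stable eq_E cover
    by (intro measure_eqI_generator_eq_countable[of ?E Omega \<mu> \<nu> ?A]) auto
qed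

section \<open>Mixtures of two alternating product measures\<close>

text \<open>
  The mass of the letter \<open>k\<close> at site \<open>i\<close> when the letter \<open>1\<close> has probability \<open>p\<close> at even sites
  and \<open>1 - p\<close> at odd ones. Passing from \<open>i\<close> to \<open>Suc i\<close> exchanges the two sublattices.
\<close>

definition alt_weight :: "real \<Rightarrow> nat \<Rightarrow> nat \<Rightarrow> real" where
  "alt_weight p i k = (if even i = (k = 1) then p else 1 - p)"

definition alt_mixture :: "real \<Rightarrow> nat list \<Rightarrow> real" where
  "alt_mixture p js = ((\<Prod>i<length js. alt_weight p i (js ! i))
      + (\<Prod>i<length js. alt_weight p (Suc i) (js ! i))) / 2"

text \<open>
  A single family of independent coins suffices: coin \<open>0\<close> is fair and selects the sublattice
  whose preferred letter is \<open>1\<close>, the other one preferring \<open>2\<close>. Coin \<open>i + 1\<close> has bias \<open>p\<close> and decides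
  whether site \<open>i\<close> shows its preferred letter. The mixture is the law of the resulting sequence.
\<close>

lemma alt_mixture_measure_exists:
  assumes p: "0 \<le> p" "p \<le> 1"
  obtains \<mu> where "prob_space \<mu>" "sets \<mu> = sets Omega_borel"
    "\<And>js. set js \<subseteq> {1, 2} \<Longrightarrow> measure \<mu> (cylinder js) = alt_mixture p js"
proof -
  define B where "B i = measure_pmf (bernoulli_pmf (if i = 0 then 1 / 2 else p))" for i :: nat
  interpret P: product_prob_space B UNIV
    unfolding B_def by unfold_locales
  define X where "X w i = (if w (Suc i) = (even i = w 0) then 1 else 2 :: nat)" for w :: "nat \<Rightarrow> bool" and i :: nat
  have comp [measurable]: "(\<lambda>w. w i) \<in> measurable (PiM UNIV B) (count_space UNIV)" for i
  proof -
    have "(\<lambda>w. w i) \<in> measurable (PiM UNIV B) (B i)" by (rule measurable_component_singleton) simp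
    moreover have "measurable (PiM UNIV B) (B i) = measurable (PiM UNIV B) (count_space UNIV)"
      by (rule measurable_cong_sets) (simp_all add: B_def)
    ultimately show ?thesis by (simp only:)
  qed
  have X: "X \<in> measurable (PiM UNIV B) Omega_borel"
  proof (subst measurable_Omega_borel_iff)
    show "X \<in> space (PiM UNIV B) \<rightarrow> Omega" by (auto simp: X_def Omega_def)
    show "\<forall>i. (\<lambda>w. X w i) \<in> measurable (PiM UNIV B) (count_space UNIV)"
      unfolding X_def by measurable
  qed
  let ?\<mu> = "distr (PiM UNIV B) Omega_borel X"
  have "measure ?\<mu> (cylinder js) = alt_mixture p js" if js: "set js \<subseteq> {1, 2}" for js
  proof -
    define n where "n = length js"
    \<comment> \<open>The outcomes of coin \<open>k\<close> compatible with the word \<open>js\<close> when coin \<open>0\<close> shows \<open>e\<close>.\<close>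
    define V where "V e k = (case k of 0 \<Rightarrow> {e} | Suc i \<Rightarrow> {(even i = e) = (js ! i = 1)})" for e k
    define C where "C e = {w \<in> space (PiM UNIV B). \<forall>k\<in>{..n}. w k \<in> V e k}" for e
    have js_nth: "js ! i = 1 \<or> js ! i = 2" if "i < n" for i
      using subsetD[OF js nth_mem[of i js]] that by (auto simp: n_def)
    have all_le: "(\<forall>k\<in>{..n}. Q k) \<longleftrightarrow> Q 0 \<and> (\<forall>i<n. Q (Suc i))" for Q
      by (simp add: Ball_def less_Suc_eq_le[symmetric] All_less_Suc2)
    have C_iff: "w \<in> C e \<longleftrightarrow> w \<in> space (PiM UNIV B) \<and> w 0 = e
        \<and> (\<forall>i<n. w (Suc i) = ((even i = e) = (js ! i = 1)))" for w e
      by (simp only: C_def all_le mem_Collect_eq) (simp add: V_def)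
    have split: "X -` cylinder js \<inter> space (PiM UNIV B) = C True \<union> C False"
    proof (rule Set.set_eqI)
      fix w
      have "X w i = js ! i \<longleftrightarrow> w (Suc i) = ((even i = w 0) = (js ! i = 1))" if "i < n" for i
        using js_nth[OF that] by (elim disjE) (simp_all add: X_def)
      moreover have "X w \<in> Omega" by (simp add: X_def Omega_def)
      ultimately have "X w \<in> cylinder js \<longleftrightarrow> (\<forall>i<n. w (Suc i) = ((even i = w 0) = (js ! i = 1)))"
        by (simp add: cylinder_def n_def)
      then show "w \<in> X -` cylinder js \<inter> space (PiM UNIV B) \<longleftrightarrow> w \<in> C True \<union> C False"
        by (cases "w 0") (simp_all add: C_iff conj_commute)
    qed
    have C_sets: "C e \<in> sets (PiM UNIV B)" for e
      unfolding C_def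
    proof (rule sets.sets_Collect_finite_All)
      show "{w \<in> space (PiM UNIV B). w k \<in> V e k} \<in> sets (PiM UNIV B)" for k
        using measurable_sets[OF comp, of "V e k" k] by (simp add: vimage_def Int_def conj_commute)
    qed simp
    have C_prob: "measure (PiM UNIV B) (C e) = (\<Prod>i<n. alt_weight p (if e then i else Suc i) (js ! i)) / 2" for e
    proof -
      have "emeasure (PiM UNIV B) (C e) = (\<Prod>k\<le>n. emeasure (B k) (V e k))"
        unfolding C_def by (rule P.emeasure_PiM_Collect) (auto simp: B_def)
      also have "\<dots> = (\<Prod>k\<le>n. ennreal (measure (B k) (V e k)))"
        by (simp add: B_def measure_pmf.emeasure_eq_measure)
      also have "\<dots> = ennreal (\<Prod>k\<le>n. measure (B k) (V e k))"
        by (simp add: prod_ennreal)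
      finally have "measure (PiM UNIV B) (C e) = (\<Prod>k\<le>n. measure (B k) (V e k))"
        by (simp add: measure_def prod_nonneg)
      also have "\<dots> = measure (B 0) (V e 0) * (\<Prod>i<n. measure (B (Suc i)) (V e (Suc i)))"
        by (simp add: lessThan_Suc_atMost[symmetric] prod.lessThan_Suc_shift del: prod.lessThan_Suc)
      also have "measure (B 0) (V e 0) = 1 / 2"
        by (cases e) (auto simp: B_def V_def measure_pmf_single)
      also have "(\<Prod>i<n. measure (B (Suc i)) (V e (Suc i)))
          = (\<Prod>i<n. alt_weight p (if e then i else Suc i) (js ! i))"
      proof (rule prod.cong[OF refl])
        fix i
        have "pmf (bernoulli_pmf p) b = (if b then p else 1 - p)" for b
          using p by (cases b) auto
        then show "measure (B (Suc i)) (V e (Suc i)) = alt_weight p (if e then i else Suc i) (js ! i)"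
          by (auto simp: B_def V_def measure_pmf_single alt_weight_def)
      qed
      finally show ?thesis by simp
    qed
    have "measure ?\<mu> (cylinder js) = measure (PiM UNIV B) (C True \<union> C False)"
      by (simp add: measure_distr[OF X] cylinder_measurable split)
    also have "\<dots> = measure (PiM UNIV B) (C True) + measure (PiM UNIV B) (C False)"
      by (intro P.P.finite_measure_Union C_sets) (auto simp: C_iff)
    finally show ?thesis by (simp add: C_prob alt_mixture_def n_def add_divide_distrib)
  qed
  then show ?thesis
    using that[of ?\<mu>] P.P.prob_space_distr[OF X] by simp
qed

text \<open>
  A function of finitely many coordinates is a finite combination of indicators of cylinders.
\<close>

lemma integral_prefix_function:
  fixes g :: "nat list \<Rightarrow> real"
  assumes "prob_space M" and M: "sets M = sets Omega_borel" and f: "\<And>x. x \<in> Omega \<Longrightarrow> f x = g (map x [0..<n])"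
  shows "integrable M f" "(\<integral>x. f x \<partial>M) = (\<Sum>w\<in>words {1, 2} n. g w * measure M (cylinder w))"
proof -
  interpret prob_space M by fact
  let ?h = "\<lambda>x. \<Sum>w\<in>words {1, 2} n. g w * indicator (cylinder w) x"
  have sp: "space M = Omega" using sets_eq_imp_space_eq[OF M] by simp
  have eq: "f x = ?h x" if "x \<in> space M" for x
  proof -
    have "?h x = (\<Sum>w\<in>words {1, 2} n. if w = map x [0..<n] then g w else 0)"
      using that sp by (intro sum.cong) (auto simp: cylinder_words)
    also have "\<dots> = f x"
      using that sp prefix_in_words[of x n] finite_words[of "{1, 2 :: nat}" n] by (simp add: f)
    finally show ?thesis by simp
  qed
  have ind: "integrable M (\<lambda>x. g w * indicator (cylinder w) x)" for w
    using cylinder_measurable[of w] M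
    by (intro integrable_mult_right integrable_real_indicator) (auto simp: emeasure_eq_measure)
  show "integrable M f"
    by (subst Bochner_Integration.integrable_cong[OF refl eq]) (use ind in auto)
  have "expectation f = expectation ?h"
    by (rule Bochner_Integration.integral_cong[OF refl eq])
  also have "\<dots> = (\<Sum>w\<in>words {1, 2} n. expectation (\<lambda>x. g w * indicator (cylinder w) x))"
    using ind by (rule Bochner_Integration.integral_sum)
  also have "\<dots> = (\<Sum>w\<in>words {1, 2} n. g w * prob (cylinder w))"
  proof (rule sum.cong[OF refl])
    fix w
    have "cylinder w \<inter> space M = cylinder w" using sp by (auto simp: cylinder_def)
    then show "expectation (\<lambda>x. g w * indicator (cylinder w) x) = g w * prob (cylinder w)" by simp
  qed
  finally show "expectation f = (\<Sum>w\<in>words {1, 2} n. g w * prob (cylinder w))" .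
qed

section \<open>Kronecker products of two-by-two matrices\<close>

lemma kronecker_dim [simp]:
  "dim_row (A \<otimes>\<^sub>K B) = dim_row A * dim_row B" "dim_col (A \<otimes>\<^sub>K B) = dim_col A * dim_col B"
  by (simp_all add: kronecker_def)

lemma kronecker_carrier [simp]:
  assumes "A \<in> carrier_mat m n" "B \<in> carrier_mat p q"
  shows "A \<otimes>\<^sub>K B \<in> carrier_mat (m * p) (n * q)"
  using assms by (intro carrier_matI) auto

lemma kronecker_index:
  assumes "i < dim_row A * dim_row B" "j < dim_col A * dim_col B"
  shows "(A \<otimes>\<^sub>K B) $$ (i, j)
    = A $$ (i div dim_row B, j div dim_col B) * B $$ (i mod dim_row B, j mod dim_col B)"
  using assms by (simp add: kronecker_def)

text \<open>
  The mixed-radix digits behind associativity of the Kronecker product.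
\<close>

lemma div_mod_of_product:
  fixes i b c :: nat
  shows "i div c div b = i div (b * c)" "i div c mod b = i mod (b * c) div c" "i mod (b * c) mod c = i mod c"
proof -
  show "i div c div b = i div (b * c)" by (simp add: div_mult2_eq mult.commute[of b])
  show "i mod (b * c) mod c = i mod c" by (simp add: mod_mod_cancel)
  show "i div c mod b = i mod (b * c) div c"
    by (cases "c = 0") (simp_all add: mult.commute[of b] mod_mult2_eq)
qed

lemma kronecker_assoc: "A \<otimes>\<^sub>K B \<otimes>\<^sub>K C = A \<otimes>\<^sub>K (B \<otimes>\<^sub>K C)"
proof (rule eq_matI)
  fix i j
  assume "i < dim_row (A \<otimes>\<^sub>K (B \<otimes>\<^sub>K C))" "j < dim_col (A \<otimes>\<^sub>K (B \<otimes>\<^sub>K C))"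
  then have i: "i < dim_row A * dim_row B * dim_row C" and j: "j < dim_col A * dim_col B * dim_col C"
    by (simp_all add: mult.assoc)
  then have "0 < dim_row B * dim_row C" "0 < dim_col B * dim_col C"
    by (auto intro!: Nat.gr0I)
  then have "i mod (dim_row B * dim_row C) < dim_row B * dim_row C"
    "j mod (dim_col B * dim_col C) < dim_col B * dim_col C" by simp_all
  then show "(A \<otimes>\<^sub>K B \<otimes>\<^sub>K C) $$ (i, j) = (A \<otimes>\<^sub>K (B \<otimes>\<^sub>K C)) $$ (i, j)"
    using i j less_mult_imp_div_less[OF i] less_mult_imp_div_less[OF j]
    by (simp add: kronecker_index mult.assoc[symmetric] div_mod_of_product)
qed (simp_all add: mult.assoc)

lemma kronecker_one [simp]: "A \<otimes>\<^sub>K 1\<^sub>m (Suc 0) = A" "1\<^sub>m (Suc 0) \<otimes>\<^sub>K A = A"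
  by (auto intro!: eq_matI simp: kronecker_index)

lemma kronecker_list_simps [simp]:
  "kronecker_list [] = 1\<^sub>m 1" "kronecker_list (A # As) = A \<otimes>\<^sub>K kronecker_list As"
  by (simp_all add: kronecker_list_def)

lemma kronecker_list_append: "kronecker_list (As @ Bs) = kronecker_list As \<otimes>\<^sub>K kronecker_list Bs"
  by (induction As) (simp_all add: kronecker_assoc)

lemma sum_div_mod:
  fixes f :: "nat \<Rightarrow> nat \<Rightarrow> 'a :: comm_monoid_add"
  shows "(\<Sum>k<m * n. f (k div n) (k mod n)) = (\<Sum>i<m. \<Sum>j<n. f i j)"
proof -
  have "(\<Sum>k<m * n. f (k div n) (k mod n)) = (\<Sum>i<m. \<Sum>k=i * n..<i * n + n. f (k div n) (k mod n))"
    by (rule sum.nat_group[symmetric])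
  also have "\<dots> = (\<Sum>i<m. \<Sum>j<n. f i j)"
  proof (rule sum.cong[OF refl])
    fix i
    have "(\<Sum>k=0 + i * n..<n + i * n. f (k div n) (k mod n))
        = (\<Sum>j=0..<n. f ((j + i * n) div n) ((j + i * n) mod n))"
      by (rule sum.shift_bounds_nat_ivl)
    also have "\<dots> = (\<Sum>j<n. f i j)" by (intro sum.cong) auto
    finally show "(\<Sum>k=i * n..<i * n + n. f (k div n) (k mod n)) = (\<Sum>j<n. f i j)"
      by (simp add: add.commute)
  qed
  finally show ?thesis .
qed

lemma mat_mult_index:
  assumes "i < dim_row A" "j < dim_col B" "dim_col A = dim_row B"
  shows "(A * B) $$ (i, j) = (\<Sum>k<dim_row B. A $$ (i, k) * B $$ (k, j))"
  using assms by (simp add: scalar_prod_def atLeast0LessThan)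

lemma kronecker_mult:
  assumes dims: "dim_col A = dim_row C" "dim_col B = dim_row D"
  shows "(A \<otimes>\<^sub>K B) * (C \<otimes>\<^sub>K D) = (A * C) \<otimes>\<^sub>K (B * D)"
proof (rule eq_matI)
  fix i j
  assume "i < dim_row ((A * C) \<otimes>\<^sub>K (B * D))" "j < dim_col ((A * C) \<otimes>\<^sub>K (B * D))"
  then have i: "i < dim_row A * dim_row B" and j: "j < dim_col C * dim_col D" by simp_all
  have pos: "0 < dim_row B" "0 < dim_col D" using i j by (auto intro!: Nat.gr0I)
  note lt = less_mult_imp_div_less[OF i] less_mult_imp_div_less[OF j]
  have "((A \<otimes>\<^sub>K B) * (C \<otimes>\<^sub>K D)) $$ (i, j)
      = (\<Sum>k<dim_row C * dim_row D. (A \<otimes>\<^sub>K B) $$ (i, k) * (C \<otimes>\<^sub>K D) $$ (k, j))"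
    using i j dims by (subst mat_mult_index) auto
  also have "\<dots> = (\<Sum>k<dim_row C * dim_row D.
      A $$ (i div dim_row B, k div dim_row D) * B $$ (i mod dim_row B, k mod dim_row D)
      * (C $$ (k div dim_row D, j div dim_col D) * D $$ (k mod dim_row D, j mod dim_col D)))"
    using i j dims by (intro sum.cong) (simp_all add: kronecker_index)
  also have "\<dots> = (\<Sum>k<dim_row C. \<Sum>l<dim_row D.
      A $$ (i div dim_row B, k) * B $$ (i mod dim_row B, l) * (C $$ (k, j div dim_col D) * D $$ (l, j mod dim_col D)))"
    by (rule sum_div_mod)
  also have "\<dots> = (\<Sum>k<dim_row C. A $$ (i div dim_row B, k) * C $$ (k, j div dim_col D))
      * (\<Sum>l<dim_row D. B $$ (i mod dim_row B, l) * D $$ (l, j mod dim_col D))"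
    by (simp add: sum_product mult.assoc mult.left_commute)
  also have "\<dots> = ((A * C) \<otimes>\<^sub>K (B * D)) $$ (i, j)"
    using i j dims pos lt by (simp add: kronecker_index mat_mult_index del: index_mult_mat(1))
  finally show "((A \<otimes>\<^sub>K B) * (C \<otimes>\<^sub>K D)) $$ (i, j) = ((A * C) \<otimes>\<^sub>K (B * D)) $$ (i, j)" .
qed simp_all

lemma kronecker_list_carrier:
  assumes "set As \<subseteq> carrier_mat 2 2"
  shows "kronecker_list As \<in> carrier_mat (2 ^ length As) (2 ^ length As)"
  using assms by (induction As) auto

text \<open>
  Conjugation by \<open>h \<otimes> \<dots> \<otimes> h\<close> acts on each tensor factor separately, by the mixed-product
  property of the Kronecker product.
\<close>

lemma kronecker_list_conjugate:
  assumes "h \<in> carrier_mat 2 2" "set As \<subseteq> carrier_mat 2 2"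
  shows "kronecker_power h (length As) * kronecker_list As * kronecker_power h (length As)
    = kronecker_list (map (\<lambda>M. h * M * h) As)"
  using assms(2)
proof (induction As)
  case (Cons M As)
  let ?W = "kronecker_power h (length As)" and ?K = "kronecker_list As"
  have W: "?W \<in> carrier_mat (2 ^ length As) (2 ^ length As)"
    using kronecker_list_carrier[of "replicate (length As) h"] assms(1)
    by (auto simp: set_replicate_conv_if split: if_splits)
  have K: "?K \<in> carrier_mat (2 ^ length As) (2 ^ length As)"
    using Cons.prems by (intro kronecker_list_carrier) auto
  have M: "M \<in> carrier_mat 2 2" using Cons.prems by simp
  have "(h \<otimes>\<^sub>K ?W) * (M \<otimes>\<^sub>K ?K) = (h * M) \<otimes>\<^sub>K (?W * ?K)"
    using assms(1) W K M by (intro kronecker_mult) auto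
  moreover have "((h * M) \<otimes>\<^sub>K (?W * ?K)) * (h \<otimes>\<^sub>K ?W) = (h * M * h) \<otimes>\<^sub>K (?W * ?K * ?W)"
    using assms(1) W K M by (intro kronecker_mult) auto
  moreover have "?W * ?K * ?W = kronecker_list (map (\<lambda>M. h * M * h) As)"
    using Cons by simp
  ultimately show ?case by simp
qed simp

lemma kronecker_power_one: "kronecker_power (1\<^sub>m 2) n = 1\<^sub>m (2 ^ n)"
proof (induction n)
  case (Suc n)
  have "1\<^sub>m 2 \<otimes>\<^sub>K 1\<^sub>m (2 ^ n) = 1\<^sub>m (2 * 2 ^ n)"
  proof (rule eq_matI)
    fix i j :: nat
    assume "i < dim_row (1\<^sub>m (2 * 2 ^ n))" "j < dim_col (1\<^sub>m (2 * 2 ^ n))"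
    then have ij: "i < 2 * 2 ^ n" "j < 2 * 2 ^ n" by simp_all
    have "i = j \<longleftrightarrow> i div 2 ^ n = j div 2 ^ n \<and> i mod 2 ^ n = j mod 2 ^ n"
      by (metis div_mult_mod_eq)
    then show "(1\<^sub>m 2 \<otimes>\<^sub>K 1\<^sub>m (2 ^ n)) $$ (i, j) = 1\<^sub>m (2 * 2 ^ n) $$ (i, j)"
      using ij less_mult_imp_div_less[OF ij(1)] less_mult_imp_div_less[OF ij(2)]
      by (simp add: kronecker_index)
  qed simp_all
  then show ?case using Suc by simp
qed simp

text \<open>
  The binary digits of \<open>a\<close>, most significant first: in the lexicographic order of the product
  basis, basis vector number \<open>a\<close> is the tensor product of the basis vectors of \<open>\<complex>\<^sup>2\<close> numbered
  by these digits.
\<close>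

fun bits :: "nat \<Rightarrow> nat \<Rightarrow> nat list" where
  "bits 0 a = []"
| "bits (Suc n) a = (a div 2 ^ n) # bits n (a mod 2 ^ n)"

lemma bits_in_words: "a < 2 ^ n \<Longrightarrow> bits n a \<in> words {0, 1} n"
proof (induction n arbitrary: a)
  case (Suc n)
  have "a div 2 ^ n < 2" using Suc.prems by (intro less_mult_imp_div_less) simp
  then show ?case using Suc.IH[of "a mod 2 ^ n"] by (auto simp: words_def)
qed (simp add: words_def)

lemma length_bits [simp]: "length (bits n a) = n"
  by (induction n arbitrary: a) auto

lemma bits_inj: "a < 2 ^ n \<Longrightarrow> b < 2 ^ n \<Longrightarrow> bits n a = bits n b \<Longrightarrow> a = b"
proof (induction n arbitrary: a b)
  case (Suc n)
  then have "a div 2 ^ n = b div 2 ^ n" "a mod 2 ^ n = b mod 2 ^ n" by auto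
  then show ?case by (metis div_mult_mod_eq)
qed simp

lemma bij_betw_bits: "bij_betw (bits n) {..<2 ^ n} (words {0, 1} n)"
proof -
  have inj: "inj_on (bits n) {..<2 ^ n}" by (auto intro!: inj_onI bits_inj)
  moreover have "bits n ` {..<2 ^ n} = words {0, 1} n"
  proof (rule card_subset_eq)
    have "card (words {0, 1 :: nat} n) = 2 ^ n"
      unfolding words_def by (subst card_lists_length_eq) (simp_all add: numeral_2_eq_2)
    then show "card (bits n ` {..<2 ^ n}) = card (words {0, 1 :: nat} n)"
      by (simp add: card_image[OF inj])
  qed (auto simp: finite_words bits_in_words[unfolded One_nat_def])
  ultimately show ?thesis by (simp add: bij_betw_def)
qed

lemma bits_nth_less:
  assumes "a < 2 ^ n" "k < n"
  shows "bits n a ! k < 2"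
proof -
  have "bits n a ! k \<in> set (bits n a)" using assms by simp
  then show ?thesis using bits_in_words[OF assms(1)] by (auto simp: words_def)
qed

lemma kronecker_list_index:
  assumes "set As \<subseteq> carrier_mat 2 2" "a < 2 ^ length As" "b < 2 ^ length As"
  shows "kronecker_list As $$ (a, b)
    = (\<Prod>i<length As. (As ! i) $$ (bits (length As) a ! i, bits (length As) b ! i))"
  using assms
proof (induction As arbitrary: a b)
  case (Cons M As)
  have K: "kronecker_list As \<in> carrier_mat (2 ^ length As) (2 ^ length As)"
    using Cons.prems by (intro kronecker_list_carrier) auto
  have M: "M \<in> carrier_mat 2 2" using Cons.prems by simp
  have "(M \<otimes>\<^sub>K kronecker_list As) $$ (a, b)
      = M $$ (a div 2 ^ length As, b div 2 ^ length As)
        * kronecker_list As $$ (a mod 2 ^ length As, b mod 2 ^ length As)"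
    using Cons.prems K M by (subst kronecker_index) auto
  then show ?case
    using Cons.prems Cons.IH[of "a mod 2 ^ length As" "b mod 2 ^ length As"]
    by (simp add: prod.lessThan_Suc_shift del: prod.lessThan_Suc)
qed simp

section \<open>Exponentials and traces of diagonalised matrices\<close>

lemma conjugate_mat_diag_index:
  fixes W :: "'a :: comm_ring_1 mat"
  assumes W: "W \<in> carrier_mat N N" and ij: "i < N" "j < N"
  shows "(W * mat_diag N d * W) $$ (i, j) = (\<Sum>c<N. W $$ (i, c) * d c * W $$ (c, j))"
proof -
  have "W * mat_diag N d = Matrix.mat N N (\<lambda>(i, j). W $$ (i, j) * d j)"
    by (rule mat_diag_mult_right[OF W])
  then show ?thesis using W ij by (auto simp: scalar_prod_def atLeast0LessThan)
qed

lemma conjugate_mat_diag_power: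
  fixes W :: "'a :: comm_ring_1 mat"
  assumes W: "W \<in> carrier_mat N N" and WW: "W * W = 1\<^sub>m N"
  shows "(W * mat_diag N d * W) ^\<^sub>m k = W * mat_diag N (\<lambda>i. d i ^ k) * W"
proof -
  have "similar_mat_wit (W * mat_diag N d * W) (mat_diag N d) W W"
    by (rule similar_mat_witI[OF WW WW refl]) (use W in auto)
  then have "(W * mat_diag N d * W) ^\<^sub>m k = W * mat_diag N d ^\<^sub>m k * W"
    by (rule similar_mat_wit_pow_id)
  moreover have "mat_diag N d ^\<^sub>m k = mat_diag N (\<lambda>i. d i ^ k)"
  proof (induction k)
    case 0
    have "dim_row (mat_diag N d) = N" by (simp add: mat_diag_def)
    then show ?case by simp
  qed (simp add: mult.commute)
  ultimately show ?thesis by simp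
qed

text \<open>
  As \<open>W W = 1\<close>, the powers of \<open>W D W\<close> are \<open>W D\<^sup>k W\<close>. Each entry is a finite combination of powers
  of the diagonal entries of \<open>D\<close>, so that the series is summed for one diagonal entry at a time.
\<close>

lemma mat_exp_conjugate_mat_diag:
  assumes W: "W \<in> carrier_mat N N" and WW: "W * W = 1\<^sub>m N"
  shows "mat_exp (W * mat_diag N d * W) = W * mat_diag N (\<lambda>i. exp (d i)) * W"
proof (rule eq_matI)
  fix i j
  assume "i < dim_row (W * mat_diag N (\<lambda>i. exp (d i)) * W)" "j < dim_col (W * mat_diag N (\<lambda>i. exp (d i)) * W)"
  then have ij: "i < N" "j < N" using W by auto
  have "(\<lambda>k. d c ^ k / fact k) sums exp (d c)" for c
    using exp_converges[of "d c"] by (simp add: scaleR_conv_of_real divide_inverse mult.commute)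
  then have "(\<lambda>k. W $$ (i, c) * (d c ^ k / fact k) * W $$ (c, j)) sums (W $$ (i, c) * exp (d c) * W $$ (c, j))" for c
    by (intro sums_mult sums_mult2)
  then have "(\<lambda>k. \<Sum>c<N. W $$ (i, c) * (d c ^ k / fact k) * W $$ (c, j))
      sums (\<Sum>c<N. W $$ (i, c) * exp (d c) * W $$ (c, j))"
    by (rule sums_sum)
  moreover have "((W * mat_diag N d * W) ^\<^sub>m k) $$ (i, j) / fact k
      = (\<Sum>c<N. W $$ (i, c) * (d c ^ k / fact k) * W $$ (c, j))" for k
    unfolding conjugate_mat_diag_power[OF W WW] conjugate_mat_diag_index[OF W ij]
    by (simp add: sum_divide_distrib)
  ultimately have "(\<lambda>k. ((W * mat_diag N d * W) ^\<^sub>m k) $$ (i, j) / fact k)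
      sums (W * mat_diag N (\<lambda>i. exp (d i)) * W) $$ (i, j)"
    by (simp add: conjugate_mat_diag_index[OF W ij] del: index_mult_mat)
  then have "(\<Sum>k. ((W * mat_diag N d * W) ^\<^sub>m k) $$ (i, j) / fact k)
      = (W * mat_diag N (\<lambda>i. exp (d i)) * W) $$ (i, j)"
    by (rule sums_unique[symmetric])
  then show "mat_exp (W * mat_diag N d * W) $$ (i, j) = (W * mat_diag N (\<lambda>i. exp (d i)) * W) $$ (i, j)"
    using W ij by (simp add: mat_exp_def del: index_mult_mat(1))
qed (use W in \<open>auto simp: mat_exp_def\<close>)

lemma mat_trace_commute:
  assumes "A \<in> carrier_mat n n" "B \<in> carrier_mat n n"
  shows "mat_trace (A * B) = mat_trace (B * A)"
proof -
  have "mat_trace (A * B) = (\<Sum>i<n. \<Sum>k<n. A $$ (i, k) * B $$ (k, i))"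
    using assms by (simp add: mat_trace_def mat_mult_index del: index_mult_mat(1))
  also have "\<dots> = (\<Sum>k<n. \<Sum>i<n. B $$ (k, i) * A $$ (i, k))"
    by (subst sum.swap) (simp add: mult.commute)
  also have "\<dots> = mat_trace (B * A)"
    using assms by (simp add: mat_trace_def mat_mult_index del: index_mult_mat(1))
  finally show ?thesis .
qed

text \<open>
  Cyclicity of the trace moves the outer \<open>W\<close> onto \<open>P\<close>; a diagonal factor then leaves only the
  diagonal of \<open>W P W\<close> visible.
\<close>

lemma mat_trace_conjugate_mat_diag_mult:
  assumes W: "W \<in> carrier_mat N N" and P: "P \<in> carrier_mat N N"
  shows "mat_trace (W * mat_diag N d * W * P) = (\<Sum>i<N. d i * (W * P * W) $$ (i, i))"
proof -
  have D: "mat_diag N d \<in> carrier_mat N N" by simp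
  have "mat_trace (W * mat_diag N d * W * P) = mat_trace (W * (mat_diag N d * W * P))"
    using W P D by (simp add: assoc_mult_mat[of _ N N _ N _ N] mult_carrier_mat[of _ N N _ N])
  also have "\<dots> = mat_trace (mat_diag N d * W * P * W)"
    by (intro mat_trace_commute[of _ N] mult_carrier_mat[of _ N N _ N] W P D)
  also have "mat_diag N d * W * P * W = mat_diag N d * (W * P * W)"
    using W P D by (simp add: assoc_mult_mat[of _ N N _ N _ N] mult_carrier_mat[of _ N N _ N])
  also have "\<dots> = Matrix.mat N N (\<lambda>(i, j). d i * (W * P * W) $$ (i, j))"
    using W P by (intro mat_diag_mult_left) auto
  finally show ?thesis by (simp add: mat_trace_def)
qed

section \<open>Diagonalisation of the chain\<close>

definition hadamard :: "complex mat" where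
  "hadamard = Matrix.mat 2 2 (\<lambda>(i, j). complex_of_real ((if i = 1 \<and> j = 1 then -1 else 1) / sqrt 2))"

definition spin :: "nat \<Rightarrow> real" where
  "spin k = (if k = 0 then 1 else -1)"

lemma hadamard_carrier [simp]: "hadamard \<in> carrier_mat 2 2"
  by (simp add: hadamard_def)

lemma less_2_iff: "i < 2 \<longleftrightarrow> i = 0 \<or> i = (1 :: nat)"
  by auto

lemma sum_lessThan_2: "(\<Sum>i<2. f i) = f 0 + f (1 :: nat)"
  by (simp add: numeral_2_eq_2)

lemma conjugate_hadamard_index:
  assumes "M \<in> carrier_mat 2 2" "i < 2" "j < 2"
  shows "(hadamard * M * hadamard) $$ (i, j)
    = (M $$ (0, 0) + spin j * M $$ (0, 1) + spin i * M $$ (1, 0) + spin i * spin j * M $$ (1, 1)) / 2"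
proof -
  define c where "c = complex_of_real (1 / sqrt 2)"
  have cc: "c * c = 1 / 2" "c * (c * x) = x / 2" for x
    by (simp_all add: c_def flip: of_real_mult mult.assoc)
  have entries: "hadamard $$ (0, 0) = c" "hadamard $$ (0, 1) = c" "hadamard $$ (1, 0) = c" "hadamard $$ (1, 1) = - c"
    by (simp_all add: hadamard_def c_def)
  note dims = carrier_matD[OF hadamard_carrier] carrier_matD[OF assms(1)]
  show ?thesis
    using assms(2,3) unfolding less_2_iff
    by (auto simp: dims entries mat_mult_index sum_lessThan_2 spin_def algebra_simps cc add_divide_distrib diff_divide_distrib
        simp del: index_mult_mat(1) One_nat_def)
qed

lemma hadamard_conjugate_one: "hadamard * 1\<^sub>m 2 * hadamard = 1\<^sub>m 2"
proof (rule eq_matI)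
  fix i j :: nat
  assume "i < dim_row (1\<^sub>m 2)" "j < dim_col (1\<^sub>m 2)"
  then have ij: "i < 2" "j < 2" by auto
  then show "(hadamard * 1\<^sub>m 2 * hadamard) $$ (i, j) = 1\<^sub>m 2 $$ (i, j)"
    by (subst conjugate_hadamard_index) (auto simp: less_2_iff spin_def)
qed (simp_all add: hadamard_def)

lemma hadamard_sigma_x:
  "sigma_x \<in> carrier_mat 2 2"
  "hadamard * sigma_x * hadamard = mat_diag 2 (\<lambda>k. complex_of_real (spin k))"
proof -
  show carr: "sigma_x \<in> carrier_mat 2 2"
    by (simp add: sigma_x_def mat_of_rows_list_def numeral_2_eq_2)
  show "hadamard * sigma_x * hadamard = mat_diag 2 (\<lambda>k. complex_of_real (spin k))"
  proof (rule eq_matI)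
    fix i j :: nat
    assume "i < dim_row (mat_diag 2 (\<lambda>k. complex_of_real (spin k)))"
      "j < dim_col (mat_diag 2 (\<lambda>k. complex_of_real (spin k)))"
    then have ij: "i < 2" "j < 2" by (auto simp: mat_diag_def)
    then show "(hadamard * sigma_x * hadamard) $$ (i, j) = mat_diag 2 (\<lambda>k. complex_of_real (spin k)) $$ (i, j)"
      by (subst conjugate_hadamard_index[OF carr])
        (auto simp: less_2_iff spin_def sigma_x_def mat_of_rows_list_def mat_diag_def)
  qed (simp_all add: hadamard_def mat_diag_def)
qed

text \<open>
  These diagonal entries are the transition probabilities
  \<open>\<bar>\<langle>\<psi>\<^sub>j, e\<^sub>k\<rangle>\<bar>\<^sup>2\<close> between \<open>\<psi>\<^sub>j\<close> and the eigenvectors \<open>e\<^sub>k\<close> of \<^const>\<open>sigma_x\<close>,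
  the columns of \<^const>\<open>hadamard\<close>.
\<close>

lemma hadamard_psi_proj:
  shows "psi_proj \<theta> j \<in> carrier_mat 2 2"
    and "k < 2 \<Longrightarrow> (hadamard * psi_proj \<theta> j * hadamard) $$ (k, k)
      = complex_of_real (if (j = 1) = (k = 0) then (1 + sin (2 * \<theta>)) / 2 else 1 - (1 + sin (2 * \<theta>)) / 2)"
proof -
  define u v where "u = (if j = 1 then cos \<theta> else - sin \<theta>)" and "v = (if j = 1 then sin \<theta> else cos \<theta>)"
  have psi: "psi \<theta> j = vec_of_list [complex_of_real u, complex_of_real v]"
    by (auto simp: psi_def u_def v_def)
  have norm: "u * u + v * v = 1"
    using sin_cos_squared_add[of \<theta>] by (auto simp: u_def v_def power2_eq_square)
  have dim: "dim_vec (psi \<theta> j) = 2" by (simp add: psi)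
  show carr: "psi_proj \<theta> j \<in> carrier_mat 2 2"
    by (simp add: psi_proj_def line_proj_def dim)
  have v0: "psi \<theta> j $ 0 = complex_of_real u" "psi \<theta> j $ 1 = complex_of_real v"
    by (simp_all add: psi vec_of_list_index)
  have "psi \<theta> j \<bullet>c psi \<theta> j = complex_of_real (u * u + v * v)"
    by (simp add: scalar_prod_def dim v0 v0(2)[unfolded One_nat_def] atLeast0LessThan sum_lessThan_2)
  then have inner: "psi \<theta> j \<bullet>c psi \<theta> j = 1" by (simp add: norm)
  have entries: "psi_proj \<theta> j $$ (a, b) = psi \<theta> j $ a * cnj (psi \<theta> j $ b)" if "a < 2" "b < 2" for a b
    using that by (simp add: psi_proj_def line_proj_def dim inner)
  assume k: "k < 2"
  have "(hadamard * psi_proj \<theta> j * hadamard) $$ (k, k)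
      = complex_of_real ((u * u + 2 * spin k * u * v + spin k * spin k * v * v) / 2)"
    using k by (subst conjugate_hadamard_index[OF carr]) (simp_all add: entries v0 v0(2)[unfolded One_nat_def] algebra_simps)
  also have "u * u + 2 * spin k * u * v + spin k * spin k * v * v = 1 + 2 * spin k * (u * v)"
    using norm by (auto simp: spin_def)
  also have "u * v = (if j = 1 then 1 else -1) * (sin (2 * \<theta>) / 2)"
    by (auto simp: u_def v_def sin_double)
  finally show "(hadamard * psi_proj \<theta> j * hadamard) $$ (k, k)
      = complex_of_real (if (j = 1) = (k = 0) then (1 + sin (2 * \<theta>)) / 2 else 1 - (1 + sin (2 * \<theta>)) / 2)"
    by (auto simp: spin_def field_simps)
qed

definition chain_energy :: "nat list \<Rightarrow> real" where
  "chain_energy w = (\<Sum>i<length w - 1. spin (w ! i) * spin (w ! Suc i))"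

abbreviation walsh :: "nat \<Rightarrow> complex mat" where
  "walsh n \<equiv> kronecker_power hadamard n"

lemma walsh_carrier: "walsh n \<in> carrier_mat (2 ^ n) (2 ^ n)"
  using kronecker_list_carrier[of "replicate n hadamard"]
  by (auto simp: set_replicate_conv_if split: if_splits)

lemma walsh_involution: "walsh n * walsh n = 1\<^sub>m (2 ^ n)"
  using kronecker_list_conjugate[OF hadamard_carrier, of "replicate n (1\<^sub>m 2)"] walsh_carrier[of n]
  by (simp add: kronecker_power_one hadamard_conjugate_one set_replicate_conv_if)

lemma walsh_swap:
  assumes "A \<in> carrier_mat (2 ^ n) (2 ^ n)" "walsh n * A * walsh n = B"
  shows "A = walsh n * B * walsh n"
proof -
  let ?W = "walsh n"
  have "?W * (?W * A * ?W) * ?W = (?W * ?W) * A * (?W * ?W)"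
    using assms(1) walsh_carrier[of n] by (simp add: assoc_mult_mat[of _ "2 ^ n" "2 ^ n" _ "2 ^ n" _ "2 ^ n"])
  then show ?thesis using assms by (simp add: walsh_involution)
qed

text \<open>
  Conjugation turns the two factors \<^const>\<open>sigma_x\<close> into \<open>diag(1, -1)\<close> and fixes the identity
  factors. A Kronecker product of diagonal matrices is diagonal because two different indices
  differ in some binary digit, where the corresponding factor vanishes.
\<close>

lemma bond_term_diagonal:
  assumes "i + 2 \<le> n"
  shows "kronecker_power (1\<^sub>m 2) i \<otimes>\<^sub>K two_site_H \<otimes>\<^sub>K kronecker_power (1\<^sub>m 2) (n - i - 2)
    = walsh n * mat_diag (2 ^ n) (\<lambda>a. complex_of_real (spin (bits n a ! i) * spin (bits n a ! Suc i))) * walsh n"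
proof (rule walsh_swap)
  define As where "As = replicate i (1\<^sub>m 2) @ [sigma_x, sigma_x] @ replicate (n - i - 2) (1\<^sub>m 2)"
  have K: "kronecker_power (1\<^sub>m 2) i \<otimes>\<^sub>K two_site_H \<otimes>\<^sub>K kronecker_power (1\<^sub>m 2) (n - i - 2) = kronecker_list As"
    unfolding As_def kronecker_list_append by (simp add: two_site_H_def kronecker_assoc)
  have As: "set As \<subseteq> carrier_mat 2 2" "length As = n"
    using assms by (auto simp: As_def hadamard_sigma_x set_replicate_conv_if)
  show "kronecker_power (1\<^sub>m 2) i \<otimes>\<^sub>K two_site_H \<otimes>\<^sub>K kronecker_power (1\<^sub>m 2) (n - i - 2) \<in> carrier_mat (2 ^ n) (2 ^ n)"
    using kronecker_list_carrier[OF As(1)] As(2) K by simp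
  define Bs where "Bs = map (\<lambda>M. hadamard * M * hadamard) As"
  have Bs: "set Bs \<subseteq> carrier_mat 2 2" "length Bs = n"
    using As by (auto simp: Bs_def intro!: mult_carrier_mat[of _ 2 2 _ 2])
  have Bs_nth: "Bs ! k = mat_diag 2 (\<lambda>l. if k = i \<or> k = Suc i then complex_of_real (spin l) else 1)" if "k < n" for k
  proof -
    have "As ! k = (if k = i \<or> k = Suc i then sigma_x else 1\<^sub>m 2)"
      using that assms by (auto simp: As_def nth_append nth_Cons split: nat.splits)
    then show ?thesis
      using that As(2) by (simp add: Bs_def hadamard_sigma_x hadamard_conjugate_one)
  qed
  have "walsh n * kronecker_list As * walsh n = kronecker_list Bs"
    using kronecker_list_conjugate[OF hadamard_carrier As(1)] by (simp add: As(2) Bs_def)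
  also have "\<dots> = mat_diag (2 ^ n) (\<lambda>a. complex_of_real (spin (bits n a ! i) * spin (bits n a ! Suc i)))"
  proof (rule eq_matI)
    fix a b :: nat
    assume "a < dim_row (mat_diag (2 ^ n) (\<lambda>a. complex_of_real (spin (bits n a ! i) * spin (bits n a ! Suc i))))"
      "b < dim_col (mat_diag (2 ^ n) (\<lambda>a. complex_of_real (spin (bits n a ! i) * spin (bits n a ! Suc i))))"
    then have ab: "a < 2 ^ n" "b < 2 ^ n" by (auto simp: mat_diag_def)
    note bit = bits_nth_less[OF ab(1)] bits_nth_less[OF ab(2)]
    have idx: "kronecker_list Bs $$ (a, b) = (\<Prod>k<n. (Bs ! k) $$ (bits n a ! k, bits n b ! k))"
      using kronecker_list_index[OF Bs(1)] ab Bs(2) by simp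
    show "kronecker_list Bs $$ (a, b)
        = mat_diag (2 ^ n) (\<lambda>a. complex_of_real (spin (bits n a ! i) * spin (bits n a ! Suc i))) $$ (a, b)"
    proof (cases "a = b")
      case True
      have "(\<Prod>k<n. (Bs ! k) $$ (bits n a ! k, bits n b ! k))
          = (\<Prod>k<n. if k \<in> {i, Suc i} then complex_of_real (spin (bits n a ! k)) else 1)"
        using True bit ab by (intro prod.cong) (auto simp: Bs_nth mat_diag_def)
      also have "\<dots> = (\<Prod>k\<in>{i, Suc i}. complex_of_real (spin (bits n a ! k)))"
        using assms by (subst prod.inter_restrict[symmetric]) (auto intro!: prod.cong)
      finally show ?thesis using True ab idx by (simp add: mat_diag_def)
    next
      case False
      then obtain k where k: "k < n" "bits n a ! k \<noteq> bits n b ! k"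
        using bits_inj[OF ab] by (metis length_bits nth_equalityI)
      then have "(Bs ! k) $$ (bits n a ! k, bits n b ! k) = 0"
        using bit ab by (simp add: Bs_nth mat_diag_def)
      then have "(\<Prod>k<n. (Bs ! k) $$ (bits n a ! k, bits n b ! k)) = 0"
        using k(1) by (intro prod_zero) auto
      then show ?thesis using False ab by (simp add: idx mat_diag_def)
    qed
  qed (use kronecker_list_carrier[OF Bs(1)] Bs(2) in \<open>auto simp: mat_diag_def\<close>)
  finally show "walsh n * (kronecker_power (1\<^sub>m 2) i \<otimes>\<^sub>K two_site_H \<otimes>\<^sub>K kronecker_power (1\<^sub>m 2) (n - i - 2)) * walsh n
      = mat_diag (2 ^ n) (\<lambda>a. complex_of_real (spin (bits n a ! i) * spin (bits n a ! Suc i)))"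
    using K by simp
qed

lemma H_chain_diagonal:
  assumes "2 \<le> n"
  shows "H_chain n = walsh n * mat_diag (2 ^ n) (\<lambda>a. complex_of_real (chain_energy (bits n a))) * walsh n"
proof (rule eq_matI)
  let ?W = "walsh n"
  fix a b
  assume "a < dim_row (?W * mat_diag (2 ^ n) (\<lambda>a. complex_of_real (chain_energy (bits n a))) * ?W)"
    "b < dim_col (?W * mat_diag (2 ^ n) (\<lambda>a. complex_of_real (chain_energy (bits n a))) * ?W)"
  then have ab: "a < 2 ^ n" "b < 2 ^ n" using walsh_carrier[of n] by auto
  have range: "{0..n - 2} = {..<n - 1}" using assms by auto
  have "H_chain n $$ (a, b) = (\<Sum>i<n - 1.
      (?W * mat_diag (2 ^ n) (\<lambda>a. complex_of_real (spin (bits n a ! i) * spin (bits n a ! Suc i))) * ?W) $$ (a, b))"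
  proof -
    have "H_chain n $$ (a, b) = (\<Sum>i<n - 1. (kronecker_power (1\<^sub>m 2) i \<otimes>\<^sub>K two_site_H
        \<otimes>\<^sub>K kronecker_power (1\<^sub>m 2) (n - i - 2)) $$ (a, b))"
      unfolding H_chain_def range using ab by simp
    also have "\<dots> = (\<Sum>i<n - 1.
      (?W * mat_diag (2 ^ n) (\<lambda>a. complex_of_real (spin (bits n a ! i) * spin (bits n a ! Suc i))) * ?W) $$ (a, b))"
    proof (rule sum.cong[OF refl])
      fix i assume "i \<in> {..<n - 1}"
      then have "i + 2 \<le> n" by auto
      then show "(kronecker_power (1\<^sub>m 2) i \<otimes>\<^sub>K two_site_H \<otimes>\<^sub>K kronecker_power (1\<^sub>m 2) (n - i - 2)) $$ (a, b)
        = (?W * mat_diag (2 ^ n) (\<lambda>a. complex_of_real (spin (bits n a ! i) * spin (bits n a ! Suc i))) * ?W) $$ (a, b)"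
        by (simp only: bond_term_diagonal)
    qed
    finally show ?thesis .
  qed
  also have "\<dots> = (\<Sum>i<n - 1. \<Sum>c<2 ^ n.
      ?W $$ (a, c) * complex_of_real (spin (bits n c ! i) * spin (bits n c ! Suc i)) * ?W $$ (c, b))"
    by (intro sum.cong refl conjugate_mat_diag_index walsh_carrier ab)
  also have "\<dots> = (\<Sum>c<2 ^ n. \<Sum>i<n - 1.
      ?W $$ (a, c) * complex_of_real (spin (bits n c ! i) * spin (bits n c ! Suc i)) * ?W $$ (c, b))"
    by (rule sum.swap)
  also have "\<dots> = (\<Sum>c<2 ^ n. ?W $$ (a, c) * complex_of_real (chain_energy (bits n c)) * ?W $$ (c, b))"
    by (simp add: chain_energy_def sum_distrib_left sum_distrib_right)
  also have "\<dots> = (?W * mat_diag (2 ^ n) (\<lambda>a. complex_of_real (chain_energy (bits n a))) * ?W) $$ (a, b)"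
    by (rule conjugate_mat_diag_index[OF walsh_carrier ab, symmetric])
  finally show "H_chain n $$ (a, b) = \<dots>" .
qed (use walsh_carrier[of n] in \<open>auto simp: H_chain_def\<close>)

lemma smult_conjugate_mat_diag:
  fixes W :: "'a :: comm_ring_1 mat"
  assumes "W \<in> carrier_mat N N"
  shows "x \<cdot>\<^sub>m (W * mat_diag N d * W) = W * mat_diag N (\<lambda>i. x * d i) * W"
proof (rule eq_matI)
  fix i j assume "i < dim_row (W * mat_diag N (\<lambda>i. x * d i) * W)" "j < dim_col (W * mat_diag N (\<lambda>i. x * d i) * W)"
  then have ij: "i < N" "j < N" using assms by auto
  have "(x \<cdot>\<^sub>m (W * mat_diag N d * W)) $$ (i, j) = x * (W * mat_diag N d * W) $$ (i, j)"
    using assms ij by (intro index_smult_mat(1)) auto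
  also have "\<dots> = (W * mat_diag N (\<lambda>i. x * d i) * W) $$ (i, j)"
    unfolding conjugate_mat_diag_index[OF assms ij] by (simp add: sum_distrib_left mult_ac)
  finally show "(x \<cdot>\<^sub>m (W * mat_diag N d * W)) $$ (i, j) = (W * mat_diag N (\<lambda>i. x * d i) * W) $$ (i, j)" .
qed (use assms in auto)

section \<open>The Gibbs state and its zero-temperature limit\<close>

definition gibbs_average :: "real \<Rightarrow> 'a set \<Rightarrow> ('a \<Rightarrow> real) \<Rightarrow> ('a \<Rightarrow> real) \<Rightarrow> real" where
  "gibbs_average \<beta> S E f = (\<Sum>w\<in>S. exp (- \<beta> * E w) * f w) / (\<Sum>w\<in>S. exp (- \<beta> * E w))"

text \<open>
  The transition probability from the eigenvector of \<^const>\<open>sigma_x\<close> numbered \<open>k\<close> to the letter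
  \<open>j\<close>, where \<open>p = (1 + sin 2\<theta>) / 2\<close>.
\<close>

definition spin_weight :: "real \<Rightarrow> nat \<Rightarrow> nat \<Rightarrow> real" where
  "spin_weight p k j = (if (j = 1) = (k = 0) then p else 1 - p)"

lemma mu_beta_eq_gibbs_average:
  assumes "2 \<le> length js"
  shows "mu_beta \<theta> \<beta> js = complex_of_real (gibbs_average \<beta> (words {0, 1} (length js)) chain_energy
    (\<lambda>w. \<Prod>i<length js. spin_weight ((1 + sin (2 * \<theta>)) / 2) (w ! i) (js ! i)))"
proof -
  define n where "n = length js"
  let ?W = "walsh n" and ?N = "2 ^ n :: nat"
  let ?g = "\<lambda>w. \<Prod>i<n. spin_weight ((1 + sin (2 * \<theta>)) / 2) (w ! i) (js ! i)"
  define Ps where "Ps = map (psi_proj \<theta>) js"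
  define E where "E = mat_exp (complex_of_real (- \<beta>) \<cdot>\<^sub>m H_chain n)"
  have Ps: "set Ps \<subseteq> carrier_mat 2 2" "length Ps = n"
    using hadamard_psi_proj(1)[of \<theta>] by (auto simp: Ps_def n_def)
  have E: "E = ?W * mat_diag ?N (\<lambda>a. complex_of_real (exp (- \<beta> * chain_energy (bits n a)))) * ?W"
    unfolding E_def using assms
    by (simp add: n_def H_chain_diagonal smult_conjugate_mat_diag[OF walsh_carrier]
        mat_exp_conjugate_mat_diag[OF walsh_carrier walsh_involution] exp_of_real[symmetric])
  have diag: "(?W * kronecker_list Ps * ?W) $$ (a, a) = complex_of_real (?g (bits n a))" if a: "a < ?N" for a
  proof -
    note bit = bits_nth_less[OF a]
    have "?W * kronecker_list Ps * ?W = kronecker_list (map (\<lambda>M. hadamard * M * hadamard) Ps)"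
      using kronecker_list_conjugate[OF hadamard_carrier Ps(1)] by (simp add: Ps(2))
    moreover have "set (map (\<lambda>M. hadamard * M * hadamard) Ps) \<subseteq> carrier_mat 2 2"
      using Ps by (auto intro!: mult_carrier_mat[of _ 2 2 _ 2])
    ultimately have "(?W * kronecker_list Ps * ?W) $$ (a, a)
        = (\<Prod>i<n. (map (\<lambda>M. hadamard * M * hadamard) Ps ! i) $$ (bits n a ! i, bits n a ! i))"
      using kronecker_list_index[of "map (\<lambda>M. hadamard * M * hadamard) Ps" a a] a Ps(2) by simp
    also have "\<dots> = (\<Prod>i<n. complex_of_real (spin_weight ((1 + sin (2 * \<theta>)) / 2) (bits n a ! i) (js ! i)))"
      using bit by (intro prod.cong) (auto simp: Ps_def n_def hadamard_psi_proj(2) spin_weight_def simp del: index_mult_mat(1))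
    finally show ?thesis by simp
  qed
  have tr: "mat_trace (E * kronecker_list Ps)
      = (\<Sum>a<?N. complex_of_real (exp (- \<beta> * chain_energy (bits n a))) * (?W * kronecker_list Ps * ?W) $$ (a, a))"
    unfolding E using kronecker_list_carrier[OF Ps(1)] Ps(2)
    by (intro mat_trace_conjugate_mat_diag_mult walsh_carrier) simp
  also have "\<dots> = complex_of_real (\<Sum>a<?N. exp (- \<beta> * chain_energy (bits n a)) * ?g (bits n a))"
    by (simp add: diag del: index_mult_mat(1))
  also have "\<dots> = complex_of_real (\<Sum>w\<in>words {0, 1} n. exp (- \<beta> * chain_energy w) * ?g w)"
    by (simp only: sum.reindex_bij_betw[OF bij_betw_bits, of "\<lambda>w. exp (- \<beta> * chain_energy w) * ?g w"])
  finally have num: "mat_trace (E * kronecker_list Ps) = \<dots>" .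
  have Ec: "E \<in> carrier_mat ?N ?N" unfolding E using walsh_carrier[of n] by auto
  have "mat_trace E = mat_trace (E * 1\<^sub>m ?N)" using Ec by simp
  also have "\<dots> = (\<Sum>a<?N. complex_of_real (exp (- \<beta> * chain_energy (bits n a))) * (?W * 1\<^sub>m ?N * ?W) $$ (a, a))"
    unfolding E by (intro mat_trace_conjugate_mat_diag_mult walsh_carrier) simp
  also have "\<dots> = complex_of_real (\<Sum>a<?N. exp (- \<beta> * chain_energy (bits n a)))"
    using walsh_carrier[of n] by (simp add: walsh_involution right_mult_one_mat del: index_mult_mat(1))
  also have "\<dots> = complex_of_real (\<Sum>w\<in>words {0, 1} n. exp (- \<beta> * chain_energy w))"
    by (simp only: sum.reindex_bij_betw[OF bij_betw_bits, of "\<lambda>w. exp (- \<beta> * chain_energy w)"])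
  finally have den: "mat_trace E = \<dots>" .
  have "mu_beta \<theta> \<beta> js = mat_trace (E * kronecker_list Ps) / mat_trace E"
    by (simp add: mu_beta_def E_def Ps_def n_def Let_def)
  then show ?thesis unfolding num den gibbs_average_def n_def by simp
qed

text \<open>
  Multiplying numerator and denominator by \<open>e\<^bsup>\<beta> e\<^esup>\<close>, where \<open>e\<close> is the minimal energy, turns every
  Boltzmann factor into one that is constantly \<open>1\<close> on the ground states and tends to \<open>0\<close> elsewhere.
\<close>

lemma gibbs_average_tendsto:
  assumes "finite S" and min: "\<And>w. w \<in> S \<Longrightarrow> e \<le> E w" and attained: "w\<^sub>0 \<in> S" "E w\<^sub>0 = e"
  shows "((\<lambda>\<beta>. gibbs_average \<beta> S E f) \<longlongrightarrow> (\<Sum>w | w \<in> S \<and> E w = e. f w) / card {w \<in> S. E w = e}) at_top"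
proof -
  have single: "((\<lambda>\<beta>. exp (- \<beta> * (E w - e))) \<longlongrightarrow> (if E w = e then 1 else 0)) at_top" if "w \<in> S" for w
  proof (cases "E w = e")
    case False
    then have "0 < E w - e" using min[OF that] by simp
    then have "((\<lambda>\<beta>. exp (- \<beta> * (E w - e))) \<longlongrightarrow> 0) at_top" by real_asymp
    then show ?thesis using False by simp
  qed simp
  have "((\<lambda>\<beta>. \<Sum>w\<in>S. exp (- \<beta> * (E w - e)) * f w) \<longlongrightarrow> (\<Sum>w\<in>S. (if E w = e then 1 else 0) * f w)) at_top"
    by (intro tendsto_sum tendsto_mult_right single)
  moreover have "((\<lambda>\<beta>. \<Sum>w\<in>S. exp (- \<beta> * (E w - e))) \<longlongrightarrow> (\<Sum>w\<in>S. if E w = e then 1 else 0)) at_top"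
    by (intro tendsto_sum single)
  moreover have card: "(\<Sum>w\<in>S. if E w = e then 1 else 0) = real (card {w \<in> S. E w = e})"
    using assms(1) by (simp add: sum.If_cases Int_def)
  moreover have "card {w \<in> S. E w = e} \<noteq> 0" using assms(1) attained by auto
  ultimately have "((\<lambda>\<beta>. (\<Sum>w\<in>S. exp (- \<beta> * (E w - e)) * f w) / (\<Sum>w\<in>S. exp (- \<beta> * (E w - e))))
      \<longlongrightarrow> (\<Sum>w\<in>S. (if E w = e then 1 else 0) * f w) / real (card {w \<in> S. E w = e})) at_top"
    by (intro tendsto_divide) auto
  moreover have "(\<Sum>w\<in>S. (if E w = e then 1 else 0) * f w) = (\<Sum>w | w \<in> S \<and> E w = e. f w)"
    using assms(1) by (simp add: sum.If_cases Int_def if_distrib[of "\<lambda>x. x * _"] cong: if_cong)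
  moreover have "(\<Sum>w\<in>S. exp (- \<beta> * (E w - e)) * f w) / (\<Sum>w\<in>S. exp (- \<beta> * (E w - e))) = gibbs_average \<beta> S E f" for \<beta>
  proof -
    have "exp (- \<beta> * (E w - e)) = exp (\<beta> * e) * exp (- \<beta> * E w)" for w
      by (simp add: exp_add[symmetric] algebra_simps)
    then show ?thesis
      by (simp add: gibbs_average_def mult.assoc sum_distrib_left[symmetric])
  qed
  ultimately show ?thesis by simp
qed

definition alternating :: "nat \<Rightarrow> nat \<Rightarrow> nat list" where
  "alternating b n = map (\<lambda>i. (i + b) mod 2) [0..<n]"

lemma chain_energy_ge: "- real (length w - 1) \<le> chain_energy w"
proof -
  have "(\<Sum>i<length w - 1. - 1) \<le> chain_energy w"
    unfolding chain_energy_def by (intro sum_mono) (auto simp: spin_def)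
  then show ?thesis by simp
qed

lemma chain_energy_minimal_iff:
  "chain_energy w = - real (length w - 1) \<longleftrightarrow> (\<forall>i<length w - 1. spin (w ! i) \<noteq> spin (w ! Suc i))"
proof -
  have "(\<Sum>i<length w - 1. spin (w ! i) * spin (w ! Suc i) + 1) = chain_energy w + real (length w - 1)"
    by (simp add: chain_energy_def sum.distrib)
  then have "chain_energy w = - real (length w - 1)
      \<longleftrightarrow> (\<Sum>i<length w - 1. spin (w ! i) * spin (w ! Suc i) + 1) = 0"
    by linarith
  also have "\<dots> \<longleftrightarrow> (\<forall>i<length w - 1. spin (w ! i) * spin (w ! Suc i) + 1 = 0)"
  proof -
    have "0 \<le> spin a * spin b + 1" for a b by (simp add: spin_def)
    then show ?thesis by (subst sum_nonneg_eq_0_iff) auto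
  qed
  also have "\<dots> \<longleftrightarrow> (\<forall>i<length w - 1. spin (w ! i) \<noteq> spin (w ! Suc i))"
  proof -
    have "spin a * spin b + 1 = 0 \<longleftrightarrow> spin a \<noteq> spin b" for a b
      by (auto simp: spin_def)
    then show ?thesis by simp
  qed
  finally show ?thesis .
qed

text \<open>
  The energy is minimal exactly if all neighbours differ, and then the first letter determines
  the word.
\<close>

lemma ground_states:
  assumes "2 \<le> n"
  shows "{w \<in> words {0, 1} n. chain_energy w = - real (n - 1)} = {alternating 0 n, alternating 1 n}"
proof (intro equalityI subsetI)
  fix w assume "w \<in> {alternating 0 n, alternating 1 n}"
  then obtain b where w: "w = alternating b n" by auto
  then have len: "length w = n" by (simp add: alternating_def)
  have "\<forall>i<length w - 1. spin (w ! i) \<noteq> spin (w ! Suc i)"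
    by (auto simp: w alternating_def spin_def) presburger+
  moreover have "w \<in> words {0, 1} n" by (auto simp: w alternating_def words_def)
  ultimately show "w \<in> {w \<in> words {0, 1} n. chain_energy w = - real (n - 1)}"
    using chain_energy_minimal_iff[of w] len by simp
next
  fix w assume "w \<in> {w \<in> words {0, 1} n. chain_energy w = - real (n - 1)}"
  then have w: "set w \<subseteq> {0, 1}" "length w = n" "\<forall>i<n - 1. spin (w ! i) \<noteq> spin (w ! Suc i)"
    using chain_energy_minimal_iff[of w] by (auto simp: words_def)
  have bit: "w ! i = 0 \<or> w ! i = 1" if "i < n" for i
    using subsetD[OF w(1) nth_mem[of i w]] that w(2) by auto
  have alt: "w ! i = (i + w ! 0) mod 2" if "i < n" for i
    using that
  proof (induction i)
    case 0
    then show ?case using bit[of 0] by auto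
  next
    case (Suc i)
    have "spin (w ! i) \<noteq> spin (w ! Suc i)" using w(3)[rule_format, of i] Suc.prems by simp
    then have "w ! Suc i = 1 - w ! i"
      using bit[OF Suc.prems] bit[of i] Suc.prems by (auto simp: spin_def split: if_splits)
    also have "w ! i = (i + w ! 0) mod 2" using Suc by simp
    also have "1 - (i + w ! 0) mod 2 = (Suc i + w ! 0) mod 2" by presburger
    finally show ?case .
  qed
  have "w = alternating (w ! 0) n"
  proof (rule nth_equalityI)
    show "length w = length (alternating (w ! 0) n)" by (simp add: alternating_def w(2))
    fix i assume "i < length w"
    then have "i < n" by (simp add: w(2))
    then have "alternating (w ! 0) n ! i = (i + w ! 0) mod 2" by (simp add: alternating_def)
    then show "w ! i = alternating (w ! 0) n ! i" using alt[OF \<open>i < n\<close>] by (simp only:)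
  qed
  moreover have "w ! 0 = 0 \<or> w ! 0 = 1" using bit[of 0] assms by simp
  ultimately show "w \<in> {alternating 0 n, alternating 1 n}" by (metis insertCI)
qed

text \<open>
  The two ground states contribute equally, and on each of them the product of transition
  probabilities is the mass of the word under one of the two alternating product measures.
\<close>

lemma mu_infty_eq_alt_mixture:
  assumes len: "2 \<le> length js"
  shows "mu_infty \<theta> js = complex_of_real (alt_mixture ((1 + sin (2 * \<theta>)) / 2) js)"
proof -
  define n where "n = length js"
  let ?p = "(1 + sin (2 * \<theta>)) / 2"
  let ?f = "\<lambda>w. \<Prod>i<n. spin_weight ?p (w ! i) (js ! i)"
  have gs: "{w \<in> words {0, 1} n. chain_energy w = - real (n - 1)} = {alternating 0 n, alternating 1 n}"
    using ground_states len by (simp add: n_def)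
  have "0 < n" using len unfolding n_def by linarith
  then have "alternating 0 n ! 0 \<noteq> alternating 1 n ! 0" by (simp add: alternating_def)
  then have ne: "alternating 0 n \<noteq> alternating 1 n" by metis
  have "((\<lambda>\<beta>. gibbs_average \<beta> (words {0, 1} n) chain_energy ?f)
      \<longlongrightarrow> (\<Sum>w | w \<in> words {0, 1} n \<and> chain_energy w = - real (n - 1). ?f w)
          / card {w \<in> words {0, 1} n. chain_energy w = - real (n - 1)}) at_top"
  proof (rule gibbs_average_tendsto)
    show "finite (words {0, 1 :: nat} n)" by (simp add: finite_words)
    show "- real (n - 1) \<le> chain_energy w" if "w \<in> words {0, 1} n" for w
      using chain_energy_ge[of w] that by (simp add: words_def)
    show "alternating 0 n \<in> words {0, 1} n" "chain_energy (alternating 0 n) = - real (n - 1)"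
      using gs by auto
  qed
  also have "(\<Sum>w | w \<in> words {0, 1} n \<and> chain_energy w = - real (n - 1). ?f w)
          / card {w \<in> words {0, 1} n. chain_energy w = - real (n - 1)}
      = (?f (alternating 0 n) + ?f (alternating 1 n)) / 2"
    using ne unfolding gs by simp
  also have "?f (alternating b n) = (\<Prod>i<n. alt_weight ?p (i + b) (js ! i))" for b
    by (intro prod.cong) (auto simp: alternating_def spin_weight_def alt_weight_def even_iff_mod_2_eq_zero)
  then have "(?f (alternating 0 n) + ?f (alternating 1 n)) / 2 = alt_mixture ?p js"
    by (simp add: alt_mixture_def n_def)
  finally have "((\<lambda>\<beta>. mu_beta \<theta> \<beta> js) \<longlongrightarrow> complex_of_real (alt_mixture ?p js)) at_top"
    using mu_beta_eq_gibbs_average[OF len] by (simp add: n_def tendsto_of_real)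
  then show ?thesis unfolding mu_infty_def by (intro tendsto_Lim) auto
qed

section \<open>Free energy and large deviations of the quantum measure\<close>

text \<open>
  The definite description is justified by \<open>alt_mixture_measure_exists\<close> for existence and
  \<open>measure_eq_if_cylinders_eq\<close> for uniqueness.
\<close>

lemma quantum_mu_properties:
  shows "prob_space (quantum_mu \<theta>)" "sets (quantum_mu \<theta>) = sets Omega_borel"
    and "\<And>js. 2 \<le> length js \<Longrightarrow> set js \<subseteq> {1, 2} \<Longrightarrow>
      measure (quantum_mu \<theta>) (cylinder js) = alt_mixture ((1 + sin (2 * \<theta>)) / 2) js"
proof -
  let ?p = "(1 + sin (2 * \<theta>)) / 2"
  let ?P = "\<lambda>\<mu>. prob_space \<mu> \<and> sets \<mu> = sets (restrict_space borel Omega) \<and>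
     (\<forall>js. length js \<ge> 2 \<and> set js \<subseteq> {1, 2} \<longrightarrow>
        complex_of_real (measure \<mu> {x \<in> Omega. \<forall>i<length js. x i = js ! i}) = mu_infty \<theta> js)"
  have P_iff: "?P \<mu> \<longleftrightarrow> prob_space \<mu> \<and> sets \<mu> = sets Omega_borel \<and>
     (\<forall>js. 2 \<le> length js \<and> set js \<subseteq> {1, 2} \<longrightarrow> measure \<mu> (cylinder js) = alt_mixture ?p js)" for \<mu>
    unfolding cylinder_def[symmetric] Omega_borel_def[symmetric]
    by (metis mu_infty_eq_alt_mixture of_real_eq_iff)
  have bias: "0 \<le> (1 + x) / 2" "(1 + x) / 2 \<le> 1" if "- 1 \<le> x" "x \<le> 1" for x :: real
    using that by simp_all
  obtain \<mu> where \<mu>: "prob_space \<mu>" "sets \<mu> = sets Omega_borel"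
    "\<And>js. set js \<subseteq> {1, 2} \<Longrightarrow> measure \<mu> (cylinder js) = alt_mixture ?p js"
    using alt_mixture_measure_exists[OF bias[OF sin_ge_minus_one sin_le_one, of "2 * \<theta>"]] by blast
  have "?P (quantum_mu \<theta>)"
    unfolding quantum_mu_def
  proof (rule theI)
    show "?P \<mu>" unfolding P_iff using \<mu> by blast
    fix \<nu> assume "?P \<nu>"
    then show "\<nu> = \<mu>" unfolding P_iff using \<mu> by (intro measure_eq_if_cylinders_eq) simp_all
  qed
  then have "prob_space (quantum_mu \<theta>) \<and> sets (quantum_mu \<theta>) = sets Omega_borel \<and>
     (\<forall>js. 2 \<le> length js \<and> set js \<subseteq> {1, 2} \<longrightarrow> measure (quantum_mu \<theta>) (cylinder js) = alt_mixture ?p js)"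
    unfolding P_iff .
  then show "prob_space (quantum_mu \<theta>)" "sets (quantum_mu \<theta>) = sets Omega_borel"
    "\<And>js. 2 \<le> length js \<Longrightarrow> set js \<subseteq> {1, 2} \<Longrightarrow>
      measure (quantum_mu \<theta>) (cylinder js) = alt_mixture ?p js"
    by blast+
qed

lemma shift_funpow: "(shift ^^ j) x = (\<lambda>i. x (i + j))"
  by (induction j) (simp_all add: shift_def)

lemma birkhoff_sum_first_coordinate:
  assumes "\<And>x. x \<in> Omega \<Longrightarrow> A x = a (x 0)" and "x \<in> Omega"
  shows "birkhoff_sum A n x = (\<Sum>j<n. a (x j))"
proof -
  have "(shift ^^ j) x \<in> Omega" for j using assms(2) by (simp add: shift_funpow Omega_def)
  then show ?thesis by (simp add: birkhoff_sum_def assms(1)) (simp add: shift_funpow)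
qed

lemma prod_even_odd:
  fixes u v :: real
  shows "(\<Prod>i<n. if even i then u else v) = (u * v) ^ (n div 2) * (if odd n then u else 1)"
  by (induction n) (auto elim!: evenE oddE)

lemma sum_alternating_products:
  fixes u v :: real
  shows "((\<Prod>i<n. if even i then u else v) + (\<Prod>i<n. if even (Suc i) then u else v)) / 2
    = (u * v) ^ (n div 2) * (if odd n then (u + v) / 2 else 1)"
proof -
  have "(\<Prod>i<n. if even (Suc i) then u else v) = (\<Prod>i<n. if even i then v else u)"
    by (intro prod.cong) auto
  then show ?thesis
    by (simp add: prod_even_odd mult.commute[of v] distrib_left add_divide_distrib)
qed

text \<open>
  Since \<open>n div 2\<close> differs from \<open>n / 2\<close> by at most one half, the logarithm differs from \<open>n (ln r) / 2\<close>
  by a bounded amount.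
\<close>

lemma half_power_growth_rate:
  fixes r s :: real
  assumes "0 < r" "0 < s"
  shows "(\<lambda>n. 1 / real n * ln (r ^ (n div 2) * (if odd n then s else 1))) \<longlonglongrightarrow> ln r / 2"
proof -
  define b where "b n = (if odd n then ln s - ln r / 2 else 0)" for n :: nat
  have eq: "1 / real n * ln (r ^ (n div 2) * (if odd n then s else 1)) = ln r / 2 + b n / real n"
    if "0 < n" for n
  proof -
    have "ln (r ^ (n div 2) * (if odd n then s else 1)) = real (n div 2) * ln r + (if odd n then ln s else 0)"
      using assms by (auto simp: ln_mult ln_realpow)
    also have "\<dots> = real n * (ln r / 2) + b n"
      by (auto simp: b_def elim!: evenE oddE) (simp add: algebra_simps add_divide_distrib)
    finally show ?thesis using that by (simp add: add_divide_distrib)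
  qed
  have "(\<lambda>n. b n / real n) \<longlonglongrightarrow> 0"
  proof (rule Lim_null_comparison)
    show "\<forall>\<^sub>F n in sequentially. norm (b n / real n) \<le> \<bar>ln s - ln r / 2\<bar> / real n"
      by (intro always_eventually allI) (auto simp: b_def divide_right_mono)
    show "(\<lambda>n. \<bar>ln s - ln r / 2\<bar> / real n) \<longlonglongrightarrow> 0" by (rule lim_const_over_n)
  qed
  then have "(\<lambda>n. ln r / 2 + b n / real n) \<longlonglongrightarrow> ln r / 2 + 0" by (intro tendsto_add tendsto_const)
  moreover have "\<forall>\<^sub>F n in sequentially. ln r / 2 + b n / real n
      = 1 / real n * ln (r ^ (n div 2) * (if odd n then s else 1))"
    using eventually_gt_at_top[of 0] by eventually_elim (rule eq[symmetric])
  ultimately have "(\<lambda>n. 1 / real n * ln (r ^ (n div 2) * (if odd n then s else 1))) \<longlonglongrightarrow> ln r / 2 + 0"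
    by (rule Lim_transform_eventually)
  then show ?thesis by simp
qed

text \<open>
  The integral is a sum over words of products over sites, which factorises for each of the two
  product measures. The factors alternate between \<open>u\<close> and \<open>v\<close>, so a pair of neighbouring sites
  contributes \<open>u v\<close>. For odd \<open>n\<close> the site left over contributes \<open>u\<close> in one product measure and \<open>v\<close>
  in the other, hence \<open>(u + v) / 2\<close> on average.
\<close>

lemma exp_birkhoff_sum_integral:
  fixes \<theta> t :: real and a :: "nat \<Rightarrow> real"
  assumes A: "\<And>x. x \<in> Omega \<Longrightarrow> A x = a (x 0)"
  defines "s \<equiv> sin (2 * \<theta>)"
  shows "integrable (quantum_mu \<theta>) (\<lambda>x. exp (t * birkhoff_sum A n x))"
    and "2 \<le> n \<Longrightarrow> (\<integral>x. exp (t * birkhoff_sum A n x) \<partial>quantum_mu \<theta>)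
      = (((exp (t * a 1) + exp (t * a 2))\<^sup>2 - s\<^sup>2 * (exp (t * a 1) - exp (t * a 2))\<^sup>2) / 4) ^ (n div 2)
        * (if odd n then (exp (t * a 1) + exp (t * a 2)) / 2 else 1)"
proof -
  define p where "p = (1 + s) / 2"
  define g where "g w = (\<Prod>j<n. exp (t * a (w ! j)))" for w :: "nat list"
  have exp_g: "exp (t * birkhoff_sum A n x) = g (map x [0..<n])" if "x \<in> Omega" for x
  proof -
    have "birkhoff_sum A n x = (\<Sum>j<n. a (x j))" using A that by (rule birkhoff_sum_first_coordinate)
    then show ?thesis by (simp add: g_def sum_distrib_left exp_sum)
  qed
  note prefix = integral_prefix_function[OF quantum_mu_properties(1,2), of "\<lambda>x. exp (t * birkhoff_sum A n x)" g n,
      OF exp_g]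
  show "integrable (quantum_mu \<theta>) (\<lambda>x. exp (t * birkhoff_sum A n x))" by (rule prefix(1))
  assume n: "2 \<le> n"
  define u v where "u = p * exp (t * a 1) + (1 - p) * exp (t * a 2)"
    and "v = (1 - p) * exp (t * a 1) + p * exp (t * a 2)"
  have letter: "(\<Sum>k\<in>{1, 2}. exp (t * a k) * alt_weight p i k) = (if even i then u else v)" for i
    by (simp add: alt_weight_def u_def v_def mult.commute)
  have words_sum: "(\<Sum>w\<in>words {1, 2} n. g w * (\<Prod>i<n. alt_weight p (i + b) (w ! i)))
      = (\<Prod>i<n. if even (i + b) then u else v)" for b
  proof -
    have "(\<Sum>w\<in>words {1, 2} n. g w * (\<Prod>i<n. alt_weight p (i + b) (w ! i)))
        = (\<Sum>w\<in>words {1, 2} n. \<Prod>i<n. exp (t * a (w ! i)) * alt_weight p (i + b) (w ! i))"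
      by (simp add: g_def prod.distrib)
    also have "\<dots> = (\<Prod>i<n. \<Sum>k\<in>{1, 2}. exp (t * a k) * alt_weight p (i + b) k)"
      by (rule sum_words_prod) simp
    also have "\<dots> = (\<Prod>i<n. if even (i + b) then u else v)"
      by (intro prod.cong refl letter)
    finally show ?thesis .
  qed
  have "(\<integral>x. exp (t * birkhoff_sum A n x) \<partial>quantum_mu \<theta>)
      = (\<Sum>w\<in>words {1, 2} n. g w * measure (quantum_mu \<theta>) (cylinder w))"
    by (rule prefix(2))
  also have "\<dots> = (\<Sum>w\<in>words {1, 2} n. g w * alt_mixture p w)"
  proof (rule sum.cong[OF refl])
    fix w :: "nat list" assume "w \<in> words {1, 2} n"
    then have "2 \<le> length w" "set w \<subseteq> {1, 2}" using n by (simp_all add: words_def)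
    then show "g w * measure (quantum_mu \<theta>) (cylinder w) = g w * alt_mixture p w"
      by (simp only: quantum_mu_properties(3) p_def s_def)
  qed
  also have "\<dots> = (\<Sum>w\<in>words {1, 2} n. (g w * (\<Prod>i<n. alt_weight p (i + 0) (w ! i))
      + g w * (\<Prod>i<n. alt_weight p (i + 1) (w ! i))) / 2)"
    by (intro sum.cong) (auto simp: alt_mixture_def words_def distrib_left)
  also have "\<dots> = ((\<Prod>i<n. if even (i + 0) then u else v) + (\<Prod>i<n. if even (i + 1) then u else v)) / 2"
    by (simp only: sum_divide_distrib[symmetric] sum.distrib words_sum)
  also have "\<dots> = (u * v) ^ (n div 2) * (if odd n then (u + v) / 2 else 1)"
    using sum_alternating_products[where n = n and u = u and v = v] by simp
  also have "u + v = exp (t * a 1) + exp (t * a 2)"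
    by (simp add: u_def v_def algebra_simps)
  also have "u * v = ((exp (t * a 1) + exp (t * a 2))\<^sup>2 - s\<^sup>2 * (exp (t * a 1) - exp (t * a 2))\<^sup>2) / 4"
    by (simp add: u_def v_def p_def power2_eq_square field_simps)
  finally show "(\<integral>x. exp (t * birkhoff_sum A n x) \<partial>quantum_mu \<theta>)
      = (((exp (t * a 1) + exp (t * a 2))\<^sup>2 - s\<^sup>2 * (exp (t * a 1) - exp (t * a 2))\<^sup>2) / 4) ^ (n div 2)
        * (if odd n then (exp (t * a 1) + exp (t * a 2)) / 2 else 1)" .
qed

lemma free_energy_argument_pos:
  fixes x y s :: real
  assumes "0 < x" "0 < y" "\<bar>s\<bar> \<le> 1"
  shows "0 < (x + y)\<^sup>2 - s\<^sup>2 * (x - y)\<^sup>2"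
proof -
  have "s\<^sup>2 * (x - y)\<^sup>2 \<le> 1 * (x - y)\<^sup>2"
    using assms(3) by (intro mult_right_mono) (auto simp: abs_square_le_1)
  also have "\<dots> < (x + y)\<^sup>2" using assms by (simp add: power2_eq_square algebra_simps)
  finally show ?thesis by simp
qed

theorem theorem2:
  fixes \<theta> :: real and A :: "(nat \<Rightarrow> nat) \<Rightarrow> real" and a :: "nat \<Rightarrow> real"
  assumes "0 < \<theta>" and "\<theta> < pi / 2"
    and "\<And>x. x \<in> Omega \<Longrightarrow> A x = a (x 0)"
  shows "(\<forall>t::real.
      (\<lambda>n. 1 / real n * ln (\<integral>x. exp (t * birkhoff_sum A n x) \<partial>quantum_mu \<theta>))
        \<longlonglongrightarrow> 1 / 2 * ln ((exp (t * a 1) + exp (t * a 2))\<^sup>2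
                     - (sin (2 * \<theta>))\<^sup>2 * (exp (t * a 1) - exp (t * a 2))\<^sup>2) - ln 2)
    \<and> large_deviation_principle (quantum_mu \<theta>) A"
proof -
  define s where "s = sin (2 * \<theta>)"
  define G where "G t = (exp (t * a 1) + exp (t * a 2))\<^sup>2 - s\<^sup>2 * (exp (t * a 1) - exp (t * a 2))\<^sup>2" for t
  define c where "c t = 1 / 2 * ln (G t) - ln 2" for t
  have G_pos: "0 < G t" for t
    unfolding G_def s_def by (intro free_energy_argument_pos) auto
  have lim: "(\<lambda>n. 1 / real n * ln (\<integral>x. exp (t * birkhoff_sum A n x) \<partial>quantum_mu \<theta>)) \<longlonglongrightarrow> c t" for t
  proof -
    define r where "r = (exp (t * a 1) + exp (t * a 2)) / 2"
    have "(\<lambda>n. 1 / real n * ln ((G t / 4) ^ (n div 2) * (if odd n then r else 1))) \<longlonglongrightarrow> ln (G t / 4) / 2"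
      using G_pos[of t] by (intro half_power_growth_rate) (auto simp: r_def add_pos_pos)
    moreover have "\<forall>\<^sub>F n in sequentially. 1 / real n * ln ((G t / 4) ^ (n div 2) * (if odd n then r else 1))
        = 1 / real n * ln (\<integral>x. exp (t * birkhoff_sum A n x) \<partial>quantum_mu \<theta>)"
      using eventually_ge_at_top[of 2]
    proof eventually_elim
      case (elim n)
      have "(\<integral>x. exp (t * birkhoff_sum A n x) \<partial>quantum_mu \<theta>) = (G t / 4) ^ (n div 2) * (if odd n then r else 1)"
        unfolding G_def r_def s_def using assms(3) elim by (rule exp_birkhoff_sum_integral(2))
      then show ?case by (simp only:)
    qed
    ultimately have "(\<lambda>n. 1 / real n * ln (\<integral>x. exp (t * birkhoff_sum A n x) \<partial>quantum_mu \<theta>))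
        \<longlonglongrightarrow> ln (G t / 4) / 2"
      by (rule Lim_transform_eventually)
    also have "ln (G t / 4) / 2 = c t"
      using G_pos[of t] ln_realpow[of 2 2] by (simp add: c_def ln_div)
    finally show ?thesis .
  qed
  have diff: "c differentiable (at t)" for t
  proof -
    have "\<exists>D. (G has_real_derivative D) (at t)"
      unfolding G_def by (rule exI) (rule derivative_eq_intros refl | simp)+
    then obtain D where "(G has_real_derivative D) (at t)" ..
    then have "(c has_real_derivative 1 / 2 * (1 / G t * D)) (at t)"
      unfolding c_def using G_pos[of t] by (auto intro!: derivative_eq_intros)
    then show ?thesis by (auto simp: real_differentiable_def)
  qed
  have space: "space (quantum_mu \<theta>) = Omega"
    using sets_eq_imp_space_eq[OF quantum_mu_properties(2)] by simp
  interpret free_energy "quantum_mu \<theta>" "birkhoff_sum A" c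
  proof (rule free_energy.intro)
    show "prob_space (quantum_mu \<theta>)" by (rule quantum_mu_properties)
    show "free_energy_axioms (quantum_mu \<theta>) (birkhoff_sum A) c"
    proof
      fix n
      have "(\<lambda>x. \<Sum>j<n. a (x j)) \<in> borel_measurable Omega_borel"
        by (intro borel_measurable_sum measurable_compose[OF measurable_coordinate]) simp
      then have "(\<lambda>x. \<Sum>j<n. a (x j)) \<in> borel_measurable (quantum_mu \<theta>)"
        by (simp cong: measurable_cong_sets[OF quantum_mu_properties(2) refl])
      then show "birkhoff_sum A n \<in> borel_measurable (quantum_mu \<theta>)"
        by (subst measurable_cong[where g = "\<lambda>x. \<Sum>j<n. a (x j)"])
          (use birkhoff_sum_first_coordinate[of A a] assms(3) space in simp_all)
      show "integrable (quantum_mu \<theta>) (\<lambda>x. exp (t * birkhoff_sum A n x))" for t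
        using assms(3) by (rule exp_birkhoff_sum_integral(1))
    qed (rule lim)
  qed
  show ?thesis
  proof (intro conjI allI)
    show "(\<lambda>n. 1 / real n * ln (\<integral>x. exp (t * birkhoff_sum A n x) \<partial>quantum_mu \<theta>))
        \<longlonglongrightarrow> 1 / 2 * ln ((exp (t * a 1) + exp (t * a 2))\<^sup>2
                     - (sin (2 * \<theta>))\<^sup>2 * (exp (t * a 1) - exp (t * a 2))\<^sup>2) - ln 2" for t
      using lim[of t] unfolding c_def G_def s_def .
    show "large_deviation_principle (quantum_mu \<theta>) A"
      unfolding large_deviation_principle_def by (rule large_deviations[OF diff])
  qed
qed

end
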